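(* Let $n\ge 1$, let $k$ be a field, $S=k[x_1,\ldots,x_n]$, and let $M$ be a monomial ideal of $S$ with minimal generating set $G$ (consisting of monomials). The following statements are equivalent: (i) $\operatorname{pd}(S/M)=n$. (ii) $G$ contains a dominant set $L$ of cardinality $n$ such that no element of $G$ strongly divides $\operatorname{lcm}(L)$.
   Context: $\operatorname{pd}$ denotes projective dimension, i.e. the largest $i$ with nonzero $i$-th Betti number. Let $L$ be a set of monomials. An element $m\in L$ is dominant (in $L$) if there is a variable $x$ such that for all $m'\in L\setminus\{m\}$ the exponent of $x$ in $m$ is strictly larger than the exponent of $x$ in $m'$. $L$ is a dominant set if each of its elements is dominant in $L$. (A subset $L$ of $G$ is called dominant if it is a dominant set in itself; its elements need not be dominant in $G$.) For monomials $l=x_1^{\alpha_1}\cdots x_n^{\alpha_n}$ and $l'=x_1^{\beta_1}\cdots x_n^{\beta_n}$, $l$ strongly divides $l'$ if $\alpha_i<\beta_i$ whenever $\alpha_i\neq 0$ (in particular $1$ strongly divides every monomial). *)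

theory Defs
  imports "HOL-Library.Poly_Mapping" "HOL-Library.Extended_Real" "HOL-Library.Cardinality"
begin

text \<open>The polynomial ring \<open>k[x\<^sub>1, \<dots>, x\<^sub>n]\<close> is the type \<open>('n, 'k) mpol\<close> for a finite index type
  \<open>'n\<close> of variables, so \<open>n = CARD('n) \<ge> 1\<close>.  Monomials are represented by their exponent vectors;
  \<open>mono_poly\<close> turns an exponent vector into the corresponding polynomial.\<close>

type_synonym 'n expo = "'n \<Rightarrow>\<^sub>0 nat"
type_synonym ('n, 'k) mpol = "('n \<Rightarrow>\<^sub>0 nat) \<Rightarrow>\<^sub>0 'k"

definition mono_poly :: "'n expo \<Rightarrow> ('n, 'k::field) mpol" where
  "mono_poly m = Poly_Mapping.single m 1"

text \<open>The ideal generated by a set is its span in the ring viewed as a module over itself.\<close>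

definition ideal_gen :: "('n, 'k::field) mpol set \<Rightarrow> ('n, 'k) mpol set" where
  "ideal_gen B = module.span (*) B"

definition monomial_ideal :: "('n, 'k::field) mpol set \<Rightarrow> bool" where
  "monomial_ideal M \<longleftrightarrow> (\<exists>A. M = ideal_gen (mono_poly ` A))"

definition minimal_monomial_generators :: "'n expo set \<Rightarrow> ('n, 'k::field) mpol set \<Rightarrow> bool" where
  "minimal_monomial_generators G M \<longleftrightarrow>
     ideal_gen (mono_poly ` G) = M \<and> (\<forall>G'. G' \<subset> G \<longrightarrow> ideal_gen (mono_poly ` G') \<noteq> M)"

definition dominant_in :: "'n expo set \<Rightarrow> 'n expo \<Rightarrow> bool" where
  "dominant_in L m \<longleftrightarrow>
     m \<in> L \<and> (\<exists>x. \<forall>m'\<in>L - {m}. Poly_Mapping.lookup m' x < Poly_Mapping.lookup m x)"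

definition dominant_set :: "'n expo set \<Rightarrow> bool" where
  "dominant_set L \<longleftrightarrow> (\<forall>m\<in>L. dominant_in L m)"

definition strongly_divides :: "'n expo \<Rightarrow> 'n expo \<Rightarrow> bool" where
  "strongly_divides l l' \<longleftrightarrow>
     (\<forall>x. Poly_Mapping.lookup l x \<noteq> 0 \<longrightarrow> Poly_Mapping.lookup l x < Poly_Mapping.lookup l' x)"

text \<open>Meant for finite \<open>L\<close>; since \<open>Sup {} = 0\<close> on the naturals, the empty set has lcm 1.\<close>

definition lcm_expo :: "'n::finite expo set \<Rightarrow> 'n expo" where
  "lcm_expo L = Abs_poly_mapping (\<lambda>x. SUP m\<in>L. Poly_Mapping.lookup m x)"

lemma lookup_lcm_expo: "Poly_Mapping.lookup (lcm_expo L) x = (SUP m\<in>L. Poly_Mapping.lookup m x)"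
  by (simp add: lcm_expo_def)

text \<open>The homogeneous maximal ideal \<open>(x\<^sub>1, \<dots>, x\<^sub>n)\<close>.\<close>

definition irrelevant_ideal :: "('n, 'k::field) mpol set" where
  "irrelevant_ideal = ideal_gen (range (\<lambda>x. mono_poly (Poly_Mapping.single x 1)))"

text \<open>The free module \<open>S\<^sup>r\<close>, its elements being coordinate sequences that vanish from index \<open>r\<close> on,
  and the linear map \<open>S\<^sup>c \<rightarrow> S\<^sup>r\<close> given by an \<open>r \<times> c\<close> matrix (entries \<open>A p q\<close> outside the
  range are ignored).\<close>

definition free_mod :: "nat \<Rightarrow> (nat \<Rightarrow> ('n, 'k::field) mpol) set" where
  "free_mod r = {u. \<forall>j\<ge>r. u j = 0}"

definition mat_map ::
  "nat \<Rightarrow> nat \<Rightarrow> (nat \<Rightarrow> nat \<Rightarrow> ('n, 'k::field) mpol) \<Rightarrow> (nat \<Rightarrow> ('n, 'k) mpol) \<Rightarrow> nat \<Rightarrow> ('n, 'k) mpol"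
where
  "mat_map r c A u = (\<lambda>p. if p < r then (\<Sum>q<c. A p q * u q) else 0)"

text \<open>Data of a free resolution \<open>\<dots> \<rightarrow> F\<^sub>2 \<rightarrow> F\<^sub>1 \<rightarrow> F\<^sub>0 \<rightarrow> S/M \<rightarrow> 0\<close>:
  \<open>F\<^sub>i\<close> is free of rank \<open>rk i\<close>, with basis elements in multidegrees \<open>dg i j\<close>;
  \<open>D i\<close> is the matrix of the differential from \<open>F\<close> at \<open>i + 1\<close> to \<open>F\<close> at \<open>i\<close>;
  the augmentation \<open>F\<^sub>0 \<rightarrow> S/M\<close> sends the \<open>j\<close>-th basis element to the residue class of \<open>e j\<close>,
  so that \<open>u\<close> is sent to the class of \<open>augment (rk 0) e u\<close>.\<close>

definition augment ::
  "nat \<Rightarrow> (nat \<Rightarrow> ('n, 'k::field) mpol) \<Rightarrow> (nat \<Rightarrow> ('n, 'k) mpol) \<Rightarrow> ('n, 'k) mpol" where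
  "augment r e u = (\<Sum>j<r. e j * u j)"

definition free_resolution ::
  "('n, 'k::field) mpol set \<Rightarrow> (nat \<Rightarrow> nat) \<Rightarrow> (nat \<Rightarrow> ('n, 'k) mpol)
     \<Rightarrow> (nat \<Rightarrow> nat \<Rightarrow> nat \<Rightarrow> ('n, 'k) mpol) \<Rightarrow> bool" where
  "free_resolution M rk e D \<longleftrightarrow>
     (\<forall>f. \<exists>u\<in>free_mod (rk 0). f - augment (rk 0) e u \<in> M) \<and>
     {u \<in> free_mod (rk 0). augment (rk 0) e u \<in> M}
       = mat_map (rk 0) (rk 1) (D 0) ` free_mod (rk 1) \<and>
     (\<forall>i. {u \<in> free_mod (rk (i + 1)). mat_map (rk i) (rk (i + 1)) (D i) u = (\<lambda>_. 0)}
       = mat_map (rk (i + 1)) (rk (i + 2)) (D (i + 1)) ` free_mod (rk (i + 2)))"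

text \<open>The augmentation and the differentials are homogeneous of multidegree 0.\<close>

definition multigraded ::
  "(nat \<Rightarrow> nat) \<Rightarrow> (nat \<Rightarrow> nat \<Rightarrow> 'n expo) \<Rightarrow> (nat \<Rightarrow> ('n, 'k::field) mpol)
     \<Rightarrow> (nat \<Rightarrow> nat \<Rightarrow> nat \<Rightarrow> ('n, 'k) mpol) \<Rightarrow> bool" where
  "multigraded rk dg e D \<longleftrightarrow>
     (\<forall>j<rk 0. \<forall>m\<in>Poly_Mapping.keys (e j). m = dg 0 j) \<and>
     (\<forall>i. \<forall>p<rk i. \<forall>q<rk (i + 1). \<forall>m\<in>Poly_Mapping.keys (D i p q). m + dg i p = dg (i + 1) q)"

text \<open>Minimality: the image of each differential lies in the maximal ideal times its target.\<close>

definition minimal_free_resolution ::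
  "('n, 'k::field) mpol set \<Rightarrow> (nat \<Rightarrow> nat) \<Rightarrow> (nat \<Rightarrow> nat \<Rightarrow> 'n expo) \<Rightarrow> (nat \<Rightarrow> ('n, 'k) mpol)
     \<Rightarrow> (nat \<Rightarrow> nat \<Rightarrow> nat \<Rightarrow> ('n, 'k) mpol) \<Rightarrow> bool" where
  "minimal_free_resolution M rk dg e D \<longleftrightarrow>
     free_resolution M rk e D \<and> multigraded rk dg e D \<and>
     (\<forall>i. \<forall>p<rk i. \<forall>q<rk (i + 1). D i p q \<in> irrelevant_ideal)"

text \<open>The \<open>i\<close>-th Betti number of \<open>S/M\<close>: the rank of the \<open>i\<close>-th module in a minimal free resolution
  (which exists, with uniquely determined ranks, for every monomial ideal \<open>M\<close>).\<close>

definition betti_quot :: "('n, 'k::field) mpol set \<Rightarrow> nat \<Rightarrow> nat" where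
  "betti_quot M i = (THE r. \<exists>rk dg e D. minimal_free_resolution M rk dg e D \<and> rk i = r)"

text \<open>The projective dimension of \<open>S/M\<close>; it is \<open>-\<infinity>\<close> if \<open>S/M = 0\<close>.\<close>

definition pd_quot :: "('n, 'k::field) mpol set \<Rightarrow> ereal" where
  "pd_quot M = (SUP i\<in>{i. betti_quot M i \<noteq> 0}. ereal (real i))"

end

theory Submission
  imports Defs "HOL-Library.Function_Algebras"
begin

text \<open>
Let \<open>S = k[x\<^sub>1, \<dots>, x\<^sub>n]\<close>.  The \<open>i\<close>-th Betti number of \<open>S/M\<close> is the dimension of
\<open>Tor\<^sub>i(S/M, k)\<close>.  It vanishes for \<open>i > n\<close>, and \<open>Tor\<^sub>n(S/M, k)\<close> is the socle of \<open>S/M\<close>, the set of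
elements killed by all variables, up to a shift in degree.  So the projective dimension is \<open>n\<close> iff there is a monomial
\<open>x\<^sup>b \<notin> M\<close> with \<open>x\<^sub>i x\<^sup>b \<in> M\<close> for all \<open>i\<close> (lemma \<open>pd_quot_eq_nvars_iff\<close>).  Choosing for each \<open>i\<close> a generator that
divides \<open>x\<^sub>i x\<^sup>b\<close> yields a dominant set of \<open>n\<close> generators with lcm \<open>x\<^sub>1 \<cdots> x\<^sub>n x\<^sup>b\<close>, and a generator
strongly divides this lcm iff it divides \<open>x\<^sup>b\<close>.  The passage can be reversed (lemma \<open>socle_iff_dominant\<close>).

The computation of \<open>Tor\<close> works in one multidegree \<open>a\<close> at a time.  There a multigraded free
resolution \<open>F\<close> is a complex of finite-dimensional vector spaces \<open>C i a\<close> with scalar matrices as differentials, and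
multiplication by a monomial is an inclusion \<open>C i a \<subseteq> C i b\<close>.  For a set \<open>\<sigma>\<close> of variables consider
the complex \<open>F/(\<sigma>) F\<close>.  It starts as a resolution of \<open>S/M\<close> for \<open>\<sigma> = {}\<close>.  Adding a
variable \<open>x\<close> gives a short exact sequence \<open>0 \<rightarrow> F/(\<sigma>) F \<rightarrow> F/(\<sigma>) F \<rightarrow> F/(\<sigma>, x) F \<rightarrow> 0\<close> with multiplication by
\<open>x\<close> as the first map.  Induction on \<open>\<sigma>\<close> shows that the homology of \<open>F/(\<sigma>) F\<close> vanishes in
homological degrees above \<open>|\<sigma>|\<close> (lemma \<open>relative_cycle_boundary\<close>) and that in homological degree \<open>|\<sigma>|\<close> it is
the part of \<open>S/M\<close> killed by \<open>\<sigma>\<close> (lemma \<open>relative_homology_top\<close>).  When \<open>\<sigma>\<close>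
contains all variables, minimality makes the differential of \<open>F/(\<sigma>) F\<close> zero, so its homology counts basis elements
(lemmas \<open>rank_beyond_zero\<close> and \<open>rank_top\<close>).

Betti numbers are ranks in a minimal resolution, so one has to be constructed.  A multigraded submodule of a
free module is a monotone family of subspaces of a fixed finite-dimensional space, indexed by the degrees.
Dickson's lemma shows that new generators appear in only finitely many degrees
(lemma \<open>finitely_many_generator_degrees\<close>), and bases of the new parts give minimal generators whose relations are
again minimal (lemma \<open>minimal_presentation_exists\<close>).
\<close>

section \<open>Degree parts of multigraded free modules\<close>

text \<open>The part in degree \<open>a\<close> of a free module whose \<open>j\<close>-th basis element has degree \<open>d j\<close>: that
basis element contributes the line spanned by its multiple by the monomial with exponent
\<open>a - d j\<close>, provided \<open>d j \<le> a\<close>.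
Only the scalar coefficient is recorded.  In this way the parts in all degrees are subspaces of
one vector space, and multiplication by a monomial becomes an inclusion.\<close>

definition degree_part :: "nat \<Rightarrow> (nat \<Rightarrow> 'n \<Rightarrow> nat) \<Rightarrow> ('n \<Rightarrow> nat) \<Rightarrow> (nat \<Rightarrow> 'k::field) set" where
  "degree_part r d a = {w. \<forall>j. w j \<noteq> 0 \<longrightarrow> j < r \<and> d j \<le> a}"

definition mat_vec :: "nat \<Rightarrow> nat \<Rightarrow> (nat \<Rightarrow> nat \<Rightarrow> 'k::field) \<Rightarrow> (nat \<Rightarrow> 'k) \<Rightarrow> nat \<Rightarrow> 'k" where
  "mat_vec r s c w = (\<lambda>p. if p < r then (\<Sum>q<s. c p q * w q) else 0)"

definition scal :: "'k::field \<Rightarrow> (nat \<Rightarrow> 'k) \<Rightarrow> nat \<Rightarrow> 'k" where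
  "scal t w = (\<lambda>j. t * w j)"

lemma scal_apply: "scal t w j = t * w j"
  by (simp add: scal_def)

definition unit_vec :: "nat \<Rightarrow> nat \<Rightarrow> 'k::field" where
  "unit_vec j = (\<lambda>l. if l = j then 1 else 0)"

lemma degree_part_zero: "0 \<in> degree_part r d a"
  by (simp add: degree_part_def)

lemma degree_part_add: "v \<in> degree_part r d a \<Longrightarrow> w \<in> degree_part r d a \<Longrightarrow> v + w \<in> degree_part r d a"
  by (auto simp: degree_part_def) (metis add_0)+

lemma degree_part_diff: "v \<in> degree_part r d a \<Longrightarrow> w \<in> degree_part r d a \<Longrightarrow> v - w \<in> degree_part r d a"
  by (auto simp: degree_part_def) (metis diff_0_right)+

lemma degree_part_scal: "w \<in> degree_part r d a \<Longrightarrow> scal t w \<in> degree_part r d a"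
  by (auto simp: degree_part_def scal_apply)

lemma degree_part_mono: "a \<le> b \<Longrightarrow> degree_part r d a \<subseteq> degree_part r d b"
  by (auto simp: degree_part_def intro: order_trans)

lemma mat_vec_zero [simp]: "mat_vec r s c 0 = 0"
  by (auto simp: mat_vec_def fun_eq_iff scal_apply)

lemma mat_vec_add: "mat_vec r s c (v + w) = mat_vec r s c v + mat_vec r s c w"
  by (auto simp: mat_vec_def fun_eq_iff scal_apply algebra_simps sum.distrib)

lemma mat_vec_diff: "mat_vec r s c (v - w) = mat_vec r s c v - mat_vec r s c w"
  by (auto simp: mat_vec_def fun_eq_iff scal_apply algebra_simps sum_subtractf)

lemma mat_vec_scal: "mat_vec r s c (scal t w) = scal t (mat_vec r s c w)"
  by (auto simp: mat_vec_def fun_eq_iff scal_apply algebra_simps sum_distrib_left)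

text \<open>A homogeneous map can have only the monomial of degree \<open>d' q - d p\<close> in position \<open>(p, q)\<close>, and
\<open>c p q\<close> is its coefficient.\<close>

definition graded_matrix ::
  "nat \<Rightarrow> nat \<Rightarrow> (nat \<Rightarrow> 'n \<Rightarrow> nat) \<Rightarrow> (nat \<Rightarrow> 'n \<Rightarrow> nat) \<Rightarrow> (nat \<Rightarrow> nat \<Rightarrow> 'k::field) \<Rightarrow> bool" where
  "graded_matrix r s d d' c \<longleftrightarrow> (\<forall>p<r. \<forall>q<s. c p q \<noteq> 0 \<longrightarrow> d p \<le> d' q)"

lemma mat_vec_nonzeroD:
  assumes "mat_vec r s c w p \<noteq> 0"
  obtains q where "p < r" "q < s" "c p q \<noteq> 0" "w q \<noteq> 0"
proof -
  have "p < r" "(\<Sum>q<s. c p q * w q) \<noteq> 0"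
    using assms by (auto simp: mat_vec_def split: if_splits)
  moreover then obtain q where "q < s" "c p q * w q \<noteq> 0"
    by (metis (mono_tags, lifting) lessThan_iff sum.neutral)
  ultimately show ?thesis using that by auto
qed

lemma mat_vec_degree_part:
  assumes "graded_matrix r s d d' c" "w \<in> degree_part s d' a"
  shows "mat_vec r s c w \<in> degree_part r d a"
  unfolding degree_part_def
proof (intro CollectI allI impI)
  fix p assume "mat_vec r s c w p \<noteq> 0"
  then obtain q where "p < r" "q < s" "c p q \<noteq> 0" "w q \<noteq> 0"
    by (rule mat_vec_nonzeroD)
  then show "p < r \<and> d p \<le> a"
    using assms by (fastforce simp: graded_matrix_def degree_part_def intro: order_trans)
qed

section \<open>Relative homology of a resolution, degree by degree\<close>

text \<open>Here \<open>N\<close> stands for the set of exponents of the monomials in \<open>M\<close>.  Writing \<open>b\<close> for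
\<open>shift a \<sigma>\<close>, which is \<open>a\<close> minus the indicator function of \<open>\<sigma>\<close>, the predicate \<open>socle_at\<close> says that
\<open>x\<^sup>b\<close> is a nonzero element of \<open>S/M\<close> killed by all variables in \<open>\<sigma>\<close>; resetting the entry at \<open>x\<close>
to \<open>a x\<close> is multiplication by that variable.  For \<open>\<sigma> = UNIV\<close> these are the socle monomials of
\<open>S/M\<close>.  They are indexed by \<open>a\<close> rather than \<open>b\<close> because \<open>a\<close> is the degree in which they
contribute to the resolution.\<close>

definition shift :: "('n \<Rightarrow> nat) \<Rightarrow> 'n set \<Rightarrow> 'n \<Rightarrow> nat" where
  "shift a \<sigma> = (\<lambda>x. if x \<in> \<sigma> then a x - 1 else a x)"

definition socle_at :: "('n \<Rightarrow> nat) set \<Rightarrow> 'n set \<Rightarrow> ('n \<Rightarrow> nat) \<Rightarrow> bool" where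
  "socle_at N \<sigma> a \<longleftrightarrow> (\<forall>x\<in>\<sigma>. 0 < a x) \<and> shift a \<sigma> \<notin> N \<and> (\<forall>x\<in>\<sigma>. (shift a \<sigma>)(x := a x) \<in> N)"

text \<open>The strands of a minimal multigraded free resolution of \<open>S/M\<close> in the single degrees \<open>a\<close>.  In degree
\<open>a\<close> the module \<open>S/M\<close> is \<open>0\<close> for \<open>a \<in> N\<close> and a line otherwise, which is why the kernel of the
augmentation is the whole degree part in the first case.\<close>

locale degreewise_resolution =
  fixes rk :: "nat \<Rightarrow> nat" and dg :: "nat \<Rightarrow> nat \<Rightarrow> 'n::finite \<Rightarrow> nat"
    and c :: "nat \<Rightarrow> nat \<Rightarrow> nat \<Rightarrow> 'k::field"
    and aug :: "nat \<Rightarrow> 'k" and N :: "('n \<Rightarrow> nat) set"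
  assumes graded: "graded_matrix (rk i) (rk (Suc i)) (dg i) (dg (Suc i)) (c i)"
    and minimal: "p < rk i \<Longrightarrow> q < rk (Suc i) \<Longrightarrow> c i p q \<noteq> 0 \<Longrightarrow> dg i p \<noteq> dg (Suc i) q"
    and aug_onto: "a \<notin> N \<Longrightarrow> \<exists>w\<in>degree_part (rk 0) (dg 0) a. (\<Sum>j<rk 0. aug j * w j) = 1"
    and exact_0: "{w \<in> degree_part (rk 0) (dg 0) a. a \<in> N \<or> (\<Sum>j<rk 0. aug j * w j) = 0}
          = mat_vec (rk 0) (rk 1) (c 0) ` degree_part (rk 1) (dg 1) a"
    and exact_Suc: "{w \<in> degree_part (rk (Suc i)) (dg (Suc i)) a. mat_vec (rk i) (rk (Suc i)) (c i) w = 0}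
          = mat_vec (rk (Suc i)) (rk (Suc (Suc i))) (c (Suc i))
              ` degree_part (rk (Suc (Suc i))) (dg (Suc (Suc i))) a"
begin

abbreviation C :: "nat \<Rightarrow> ('n \<Rightarrow> nat) \<Rightarrow> (nat \<Rightarrow> 'k) set" where
  "C i a \<equiv> degree_part (rk i) (dg i) a"

text \<open>The differential out of \<open>F\<^sub>i\<close>; it is \<open>0\<close> for \<open>i = 0\<close>, so that cycles make sense in
every homological degree.\<close>

definition bd :: "nat \<Rightarrow> (nat \<Rightarrow> 'k) \<Rightarrow> nat \<Rightarrow> 'k" where
  "bd i w = (case i of 0 \<Rightarrow> 0 | Suc l \<Rightarrow> mat_vec (rk l) (rk (Suc l)) (c l) w)"

lemma bd_zero: "bd i 0 = 0"
  and bd_add: "bd i (v + w) = bd i v + bd i w"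
  and bd_diff: "bd i (v - w) = bd i v - bd i w"
  and bd_scal: "bd i (scal t w) = scal t (bd i w)"
  by (simp_all add: bd_def mat_vec_add mat_vec_diff mat_vec_scal fun_eq_iff scal_apply split: nat.split)

lemma bd_degree_part: "w \<in> C (Suc i) a \<Longrightarrow> bd (Suc i) w \<in> C i a"
  by (simp add: bd_def mat_vec_degree_part[OF graded])

lemma bd_bd: "w \<in> C (Suc i) a \<Longrightarrow> bd i (bd (Suc i) w) = 0"
  using exact_Suc[of "i - 1" a] by (cases i) (auto simp: bd_def)

lemma bd_exact: "w \<in> C (Suc i) a \<Longrightarrow> bd (Suc i) w = 0 \<Longrightarrow> \<exists>v\<in>C (Suc (Suc i)) a. bd (Suc (Suc i)) v = w"
  using exact_Suc[of i a] by (simp add: bd_def set_eq_iff image_iff) metis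

text \<open>A basis element of degree \<open>d\<close> contributes to the degree \<open>a\<close> part of \<open>(\<sigma>) F\<^sub>i\<close>, where \<open>(\<sigma>)\<close> is the
ideal generated by the variables in \<open>\<sigma>\<close>, iff \<open>a - d\<close> is positive at some variable in \<open>\<sigma>\<close>.  So
\<open>R i a \<sigma>\<close> is this degree part, and \<open>C i a\<close> modulo \<open>R i a \<sigma>\<close> is the degree \<open>a\<close> part of
\<open>F\<^sub>i/(\<sigma>) F\<^sub>i\<close>.  The sets \<open>Z\<close> and \<open>B\<close> consist of the representatives in \<open>C i a\<close> of the cycles and
the boundaries of the quotient complex.\<close>

definition R :: "nat \<Rightarrow> ('n \<Rightarrow> nat) \<Rightarrow> 'n set \<Rightarrow> (nat \<Rightarrow> 'k) set" where
  "R i a \<sigma> = {w \<in> C i a. \<forall>j. w j \<noteq> 0 \<longrightarrow> (\<exists>x\<in>\<sigma>. dg i j x < a x)}"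

definition Z :: "nat \<Rightarrow> ('n \<Rightarrow> nat) \<Rightarrow> 'n set \<Rightarrow> (nat \<Rightarrow> 'k) set" where
  "Z i a \<sigma> = {w \<in> C i a. bd i w \<in> R (i - 1) a \<sigma>}"

definition B :: "nat \<Rightarrow> ('n \<Rightarrow> nat) \<Rightarrow> 'n set \<Rightarrow> (nat \<Rightarrow> 'k) set" where
  "B i a \<sigma> = {w \<in> C i a. \<exists>v\<in>C (Suc i) a. w - bd (Suc i) v \<in> R i a \<sigma>}"

lemma R_degree_part: "w \<in> R i a \<sigma> \<Longrightarrow> w \<in> C i a"
  by (simp add: R_def)

lemma R_zero: "0 \<in> R i a \<sigma>"
  by (simp add: R_def degree_part_zero)

lemma R_add: "v \<in> R i a \<sigma> \<Longrightarrow> w \<in> R i a \<sigma> \<Longrightarrow> v + w \<in> R i a \<sigma>"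
  by (auto simp: R_def degree_part_add) (metis add_0)

lemma R_diff: "v \<in> R i a \<sigma> \<Longrightarrow> w \<in> R i a \<sigma> \<Longrightarrow> v - w \<in> R i a \<sigma>"
  by (auto simp: R_def degree_part_diff) (metis diff_0_right)

lemma R_scal: "w \<in> R i a \<sigma> \<Longrightarrow> scal t w \<in> R i a \<sigma>"
  by (auto simp: R_def degree_part_scal scal_apply)

lemma R_mono: "\<sigma> \<subseteq> \<tau> \<Longrightarrow> R i a \<sigma> \<subseteq> R i a \<tau>"
  unfolding R_def by blast

lemma R_empty: "w \<in> R i a {} \<longleftrightarrow> w = 0"
  by (auto simp: R_def degree_part_def fun_eq_iff scal_apply)

lemma bd_R:
  assumes "w \<in> R (Suc i) a \<sigma>"
  shows "bd (Suc i) w \<in> R i a \<sigma>"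
proof -
  have "\<exists>x\<in>\<sigma>. dg i p x < a x" if "bd (Suc i) w p \<noteq> 0" for p
  proof -
    from that obtain q where q: "p < rk i" "q < rk (Suc i)" "c i p q \<noteq> 0" "w q \<noteq> 0"
      by (auto simp: bd_def elim: mat_vec_nonzeroD)
    then have "dg i p \<le> dg (Suc i) q" using graded[of i] by (auto simp: graded_matrix_def)
    moreover obtain x where "x \<in> \<sigma>" "dg (Suc i) q x < a x" using assms q by (auto simp: R_def)
    ultimately show ?thesis by (auto simp: le_fun_def intro: le_less_trans)
  qed
  then show ?thesis using assms by (auto simp: R_def bd_degree_part)
qed

lemma B_iff: "w \<in> B i a \<sigma> \<longleftrightarrow> (\<exists>v\<in>C (Suc i) a. \<exists>r\<in>R i a \<sigma>. w = bd (Suc i) v + r)"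
proof
  assume "w \<in> B i a \<sigma>"
  then obtain v where "v \<in> C (Suc i) a" "w - bd (Suc i) v \<in> R i a \<sigma>" by (auto simp: B_def)
  then show "\<exists>v\<in>C (Suc i) a. \<exists>r\<in>R i a \<sigma>. w = bd (Suc i) v + r"
    by (intro bexI[of _ v] bexI[of _ "w - bd (Suc i) v"]) (auto simp: fun_eq_iff scal_apply)
next
  assume "\<exists>v\<in>C (Suc i) a. \<exists>r\<in>R i a \<sigma>. w = bd (Suc i) v + r"
  then obtain v r where vr: "v \<in> C (Suc i) a" "r \<in> R i a \<sigma>" "w = bd (Suc i) v + r"
    by blast
  moreover from vr have "w - bd (Suc i) v \<in> R i a \<sigma>" by simp
  moreover from vr have "w \<in> C i a" by (simp add: bd_degree_part degree_part_add R_degree_part)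
  ultimately show "w \<in> B i a \<sigma>"
    unfolding B_def by blast
qed

lemma B_add: "v \<in> B i a \<sigma> \<Longrightarrow> w \<in> B i a \<sigma> \<Longrightarrow> v + w \<in> B i a \<sigma>"
  unfolding B_iff
proof (elim bexE)
  fix s r t q
  assume "s \<in> C (Suc i) a" "r \<in> R i a \<sigma>" "v = bd (Suc i) s + r"
    "t \<in> C (Suc i) a" "q \<in> R i a \<sigma>" "w = bd (Suc i) t + q"
  then show "\<exists>u\<in>C (Suc i) a. \<exists>r\<in>R i a \<sigma>. v + w = bd (Suc i) u + r"
    by (intro bexI[of _ "s + t"] bexI[of _ "r + q"]) (auto simp: degree_part_add R_add bd_add)
qed

lemma B_scal: "w \<in> B i a \<sigma> \<Longrightarrow> scal t w \<in> B i a \<sigma>"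
  unfolding B_iff
proof (elim bexE)
  fix s r
  assume "s \<in> C (Suc i) a" "r \<in> R i a \<sigma>" "w = bd (Suc i) s + r"
  then show "\<exists>u\<in>C (Suc i) a. \<exists>r\<in>R i a \<sigma>. scal t w = bd (Suc i) u + r"
    by (intro bexI[of _ "scal t s"] bexI[of _ "scal t r"])
      (auto simp: degree_part_scal R_scal bd_scal fun_eq_iff scal_apply algebra_simps)
qed

lemma B_diff: "v \<in> B i a \<sigma> \<Longrightarrow> w \<in> B i a \<sigma> \<Longrightarrow> v - w \<in> B i a \<sigma>"
proof -
  assume "v \<in> B i a \<sigma>" "w \<in> B i a \<sigma>"
  then have "v + scal (-1) w \<in> B i a \<sigma>" by (intro B_add B_scal)
  moreover have "v + scal (-1) w = v - w" by (simp add: fun_eq_iff scal_apply)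
  ultimately show ?thesis by simp
qed

text \<open>\<open>lower a x\<close> is the degree \<open>a - e\<^sub>x\<close>, truncated at \<open>0\<close>.  Elements of that degree part are to be
thought of as multiplied by the variable \<open>x\<close>.\<close>

abbreviation lower :: "('n \<Rightarrow> nat) \<Rightarrow> 'n \<Rightarrow> 'n \<Rightarrow> nat" where
  "lower a x \<equiv> a(x := a x - 1)"

lemma lower_le: "lower a x \<le> a"
  by (simp add: le_fun_def)

lemma degree_part_lower: "w \<in> C i (lower a x) \<Longrightarrow> w \<in> C i a"
  using degree_part_mono[OF lower_le] by blast

text \<open>Multiplication by \<open>x\<close> is injective on \<open>F/(\<sigma>) F\<close> for \<open>x \<notin> \<sigma>\<close>.\<close>

lemma R_lower:
  assumes "x \<notin> \<sigma>" "w \<in> C i (lower a x)"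
  shows "w \<in> R i (lower a x) \<sigma> \<longleftrightarrow> w \<in> R i a \<sigma>"
proof -
  have "lower a x y = a y" if "y \<in> \<sigma>" for y using assms(1) that by auto
  then show ?thesis using assms(2) degree_part_lower[OF assms(2)] by (simp add: R_def)
qed

lemma degree_part_lower_R:
  assumes "0 < a x" "w \<in> C i (lower a x)"
  shows "w \<in> R i a (insert x \<sigma>)"
proof -
  have "dg i j x < a x" if "w j \<noteq> 0" for j
  proof -
    have "dg i j \<le> lower a x" using assms(2) that by (auto simp: degree_part_def)
    then have "dg i j x \<le> lower a x x" by (rule le_funD)
    then show ?thesis using assms(1) by simp
  qed
  then show ?thesis using degree_part_lower[OF assms(2)] by (simp add: R_def)
qed

text \<open>\<open>(\<sigma>, x) F = (\<sigma>) F + x F\<close>, by sorting basis elements according to their degree in \<open>x\<close>.\<close>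

lemma R_insert_split:
  assumes "w \<in> R i a (insert x \<sigma>)"
  obtains y z where "w = y + z" "y \<in> R i a \<sigma>" "z \<in> C i (lower a x)"
proof
  let ?z = "\<lambda>j. if dg i j x < a x then w j else 0"
  let ?y = "\<lambda>j. if dg i j x < a x then 0 else w j"
  show "w = ?y + ?z" by (auto simp: fun_eq_iff scal_apply)
  show "?y \<in> R i a \<sigma>" using assms by (auto simp: R_def degree_part_def)
  show "?z \<in> C i (lower a x)" using assms by (auto simp: R_def degree_part_def le_fun_def)
qed

lemma R_insert_zero: "a x = 0 \<Longrightarrow> R i a (insert x \<sigma>) = R i a \<sigma>"
  by (auto simp: R_def)

lemma Z_insert_zero: "a x = 0 \<Longrightarrow> Z i a (insert x \<sigma>) = Z i a \<sigma>"
  and B_insert_zero: "a x = 0 \<Longrightarrow> B i a (insert x \<sigma>) = B i a \<sigma>"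
  by (simp_all add: Z_def B_def R_insert_zero)

lemma Z_lower:
  assumes "x \<notin> \<sigma>" "w \<in> Z i (lower a x) \<sigma>"
  shows "w \<in> Z i a \<sigma>"
proof (cases i)
  case 0
  then show ?thesis using assms(2) degree_part_lower[of w 0 a x] by (simp add: Z_def bd_def R_zero)
next
  case (Suc l)
  then have "bd i w \<in> C (i - 1) (lower a x)" using assms by (auto simp: Z_def intro: bd_degree_part)
  then have "bd i w \<in> R (i - 1) a \<sigma>"
    using assms(2) R_lower[OF assms(1)] unfolding Z_def by blast
  then show ?thesis using assms(2) degree_part_lower[of w i a x] unfolding Z_def by blast
qed

text \<open>The connecting homomorphism of the short exact sequence
\<open>0 \<rightarrow> F/(\<sigma>) F \<rightarrow> F/(\<sigma>) F \<rightarrow> F/(\<sigma>, x) F \<rightarrow> 0\<close>, whose first map is multiplication by \<open>x\<close>: it sends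
the class of a cycle \<open>w\<close> in degree \<open>a\<close> to the class of \<open>z\<close> in degree \<open>a - e\<^sub>x\<close>.\<close>

lemma connecting_exists:
  assumes "x \<notin> \<sigma>" "w \<in> Z (Suc i) a (insert x \<sigma>)"
  obtains z where "z \<in> Z i (lower a x) \<sigma>" "bd (Suc i) w - z \<in> R i a \<sigma>"
proof -
  have wC: "w \<in> C (Suc i) a" and "bd (Suc i) w \<in> R i a (insert x \<sigma>)"
    using assms by (auto simp: Z_def)
  then obtain y z where yz: "bd (Suc i) w = y + z" "y \<in> R i a \<sigma>" "z \<in> C i (lower a x)"
    by (elim R_insert_split)
  have "bd i z \<in> R (i - 1) (lower a x) \<sigma>"
  proof (cases i)
    case 0
    then show ?thesis by (simp add: bd_def R_zero)
  next
    case (Suc l)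
    have "0 = bd i y + bd i z" using bd_bd[OF wC] by (simp add: yz bd_add)
    then have "bd i z = 0 - bd i y" by (auto simp: fun_eq_iff scal_apply) (metis eq_neg_iff_add_eq_0 add.commute)
    moreover have "bd i y \<in> R l a \<sigma>" using yz(2) Suc by (auto intro: bd_R)
    ultimately have "bd i z \<in> R l a \<sigma>" using R_diff[OF R_zero] by metis
    moreover have "bd i z \<in> C l (lower a x)" using yz Suc by (auto intro: bd_degree_part)
    ultimately show ?thesis using R_lower[OF assms(1)] Suc by auto
  qed
  then have "z \<in> Z i (lower a x) \<sigma>" using yz by (simp add: Z_def)
  moreover have "bd (Suc i) w - z \<in> R i a \<sigma>" using yz by simp
  ultimately show ?thesis using that by blast
qed

text \<open>The connecting homomorphism is well defined on homology classes; its converse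
\<open>connecting_boundary_conv\<close> is injectivity, which holds as soon as the homology of \<open>F/(\<sigma>) F\<close> in the
homological degree of \<open>w\<close> vanishes.\<close>

lemma connecting_boundary:
  assumes x: "x \<notin> \<sigma>" "0 < a x"
    and w: "w \<in> C (Suc i) a" and z: "z \<in> C i (lower a x)" and wz: "bd (Suc i) w - z \<in> R i a \<sigma>"
    and wB: "w \<in> B (Suc i) a (insert x \<sigma>)"
  shows "z \<in> B i (lower a x) \<sigma>"
proof -
  obtain t r where tr: "t \<in> C (Suc (Suc i)) a" "r \<in> R (Suc i) a (insert x \<sigma>)" "w = bd (Suc (Suc i)) t + r"
    using wB by (auto simp: B_iff)
  obtain y v where yv: "r = y + v" "y \<in> R (Suc i) a \<sigma>" "v \<in> C (Suc i) (lower a x)"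
    using R_insert_split[OF tr(2)] .
  have "bd (Suc i) w = bd (Suc i) y + bd (Suc i) v"
    by (simp add: tr(3) yv(1) bd_add bd_bd[OF tr(1)])
  then have eq: "z - bd (Suc i) v = bd (Suc i) y - (bd (Suc i) w - z)"
    by (simp add: fun_eq_iff scal_apply)
  have "z - bd (Suc i) v \<in> R i a \<sigma>"
    unfolding eq by (rule R_diff[OF bd_R[OF yv(2)] wz])
  moreover have "z - bd (Suc i) v \<in> C i (lower a x)"
    using z yv(3) by (intro degree_part_diff bd_degree_part)
  ultimately have "z - bd (Suc i) v \<in> R i (lower a x) \<sigma>" using R_lower[OF x(1)] by blast
  then show ?thesis using z yv(3) by (auto simp: B_def)
qed

lemma connecting_boundary_conv:
  assumes x: "x \<notin> \<sigma>" "0 < a x"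
    and w: "w \<in> C (Suc i) a" and wz: "bd (Suc i) w - z \<in> R i a \<sigma>"
    and zB: "z \<in> B i (lower a x) \<sigma>"
    and vanish: "Z (Suc i) a \<sigma> \<subseteq> B (Suc i) a \<sigma>"
  shows "w \<in> B (Suc i) a (insert x \<sigma>)"
proof -
  obtain v r where vr: "v \<in> C (Suc i) (lower a x)" "r \<in> R i (lower a x) \<sigma>" "z = bd (Suc i) v + r"
    using zB by (auto simp: B_iff)
  have "r \<in> R i a \<sigma>" using vr R_lower[OF x(1)] R_degree_part by blast
  moreover have "bd (Suc i) (w - v) = (bd (Suc i) w - z) + r"
    by (simp add: bd_diff vr(3) fun_eq_iff scal_apply)
  ultimately have "bd (Suc i) (w - v) \<in> R i a \<sigma>" using wz R_add by metis
  then have "w - v \<in> Z (Suc i) a \<sigma>" using w degree_part_lower[OF vr(1)] by (simp add: Z_def degree_part_diff)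
  then obtain t q where tq: "t \<in> C (Suc (Suc i)) a" "q \<in> R (Suc i) a \<sigma>" "w - v = bd (Suc (Suc i)) t + q"
    using vanish B_iff[of "w - v" "Suc i" a \<sigma>] by blast
  have "w = bd (Suc (Suc i)) t + (q + v)"
    using tq(3) by (simp add: fun_eq_iff scal_apply algebra_simps)
  moreover have "q + v \<in> R (Suc i) a (insert x \<sigma>)"
    using tq(2) R_mono[OF subset_insertI] degree_part_lower_R[OF x(2) vr(1)] by (intro R_add) blast+
  ultimately show ?thesis using tq(1) by (auto simp: B_iff)
qed

text \<open>By the long exact sequence, adding one variable to \<open>\<sigma>\<close> raises the largest homological degree with
nonzero homology by at most one; for \<open>\<sigma> = {}\<close> the complex is a resolution.  This is the
vanishing of \<open>Tor\<^sub>i(S/M, S/(\<sigma>))\<close> for \<open>i > |\<sigma>|\<close>.\<close>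

lemma relative_cycle_boundary:
  assumes "finite \<sigma>" "card \<sigma> < i"
  shows "Z i a \<sigma> \<subseteq> B i a \<sigma>"
  using assms
proof (induction \<sigma> arbitrary: i a rule: finite_induct)
  case empty
  then obtain l where "i = Suc l" by (cases i) auto
  then show ?case
    using bd_exact[of _ l a] by (force simp: Z_def B_iff R_empty)
next
  case (insert x \<sigma>)
  then obtain l where i: "i = Suc l" and l: "card \<sigma> < l" by (cases i) auto
  have van: "Z i a \<sigma> \<subseteq> B i a \<sigma>" using insert.IH[of i a] i l by simp
  show ?case
  proof (cases "a x = 0")
    case True
    then show ?thesis using van by (simp add: Z_insert_zero B_insert_zero)
  next
    case False
    show ?thesis
    proof
      fix w assume w: "w \<in> Z i a (insert x \<sigma>)"
      then obtain z where z: "z \<in> Z l (lower a x) \<sigma>" "bd (Suc l) w - z \<in> R l a \<sigma>"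
        using connecting_exists insert.hyps i by metis
      then have "z \<in> B l (lower a x) \<sigma>" using insert.IH[OF l] by blast
      then show "w \<in> B i a (insert x \<sigma>)"
        using connecting_boundary_conv[of x \<sigma> a w l z] insert.hyps False w z van i by (auto simp: Z_def)
    qed
  qed
qed

lemma shift_insert: "x \<notin> \<sigma> \<Longrightarrow> shift a (insert x \<sigma>) = shift (lower a x) \<sigma>"
  by (auto simp: shift_def fun_eq_iff scal_apply)

lemma shift_lower_upd: "x \<notin> \<sigma> \<Longrightarrow> (shift (lower a x) \<sigma>)(x := a x) = shift a \<sigma>"
  by (auto simp: shift_def fun_eq_iff scal_apply)

lemma socle_at_insert:
  assumes "x \<notin> \<sigma>"
  shows "socle_at N (insert x \<sigma>) a \<longleftrightarrow> 0 < a x \<and> socle_at N \<sigma> (lower a x) \<and> shift a \<sigma> \<in> N"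
proof -
  have "(\<forall>y\<in>\<sigma>. 0 < lower a x y) \<longleftrightarrow> (\<forall>y\<in>\<sigma>. 0 < a y)" using assms by auto
  moreover have "(\<forall>y\<in>\<sigma>. (shift (lower a x) \<sigma>)(y := lower a x y) \<in> N) \<longleftrightarrow>
      (\<forall>y\<in>\<sigma>. (shift (lower a x) \<sigma>)(y := a y) \<in> N)"
    using assms by (intro ball_cong) auto
  ultimately show ?thesis
    unfolding socle_at_def shift_insert[OF assms] using shift_lower_upd[OF assms, of a] by auto
qed

text \<open>The class of \<open>w0\<close> spans the homology of \<open>F/(\<sigma>) F\<close> in homological degree \<open>|\<sigma>|\<close> and degree \<open>a\<close>.  The
last clause expresses naturality in the degree: the class survives multiplication by a monomial in
the variables outside \<open>\<sigma>\<close> as long as the corresponding monomial of \<open>S/M\<close>, with exponent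
\<open>shift b \<sigma>\<close>, is nonzero.  For \<open>b = a\<close> this means that \<open>w0\<close> is not a boundary; the induction on \<open>\<sigma>\<close>
uses it for \<open>b = a + e\<^sub>x\<close>.\<close>

definition generator :: "('n \<Rightarrow> nat) \<Rightarrow> 'n set \<Rightarrow> (nat \<Rightarrow> 'k) \<Rightarrow> bool" where
  "generator a \<sigma> w0 \<longleftrightarrow> w0 \<in> Z (card \<sigma>) a \<sigma> \<and>
     (\<forall>w\<in>Z (card \<sigma>) a \<sigma>. \<exists>t. w - scal t w0 \<in> B (card \<sigma>) a \<sigma>) \<and>
     (\<forall>b. a \<le> b \<longrightarrow> (\<forall>x\<in>\<sigma>. b x = a x) \<longrightarrow> shift b \<sigma> \<notin> N \<longrightarrow> w0 \<notin> B (card \<sigma>) b \<sigma>)"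

lemma Z_empty: "Z 0 a {} = C 0 a"
  by (simp add: Z_def R_empty bd_def)

lemma B_empty: "w \<in> B 0 a {} \<longleftrightarrow> w \<in> C 0 a \<and> (a \<in> N \<or> (\<Sum>j<rk 0. aug j * w j) = 0)"
proof -
  have "w \<in> B 0 a {} \<longleftrightarrow> w \<in> mat_vec (rk 0) (rk 1) (c 0) ` C 1 a"
    by (auto simp: B_iff R_empty bd_def)
  also have "\<dots> \<longleftrightarrow> w \<in> {w \<in> C 0 a. a \<in> N \<or> (\<Sum>j<rk 0. aug j * w j) = 0}"
    by (simp only: exact_0)
  finally show ?thesis by simp
qed

lemma generator_empty:
  assumes "a \<notin> N"
  obtains w0 where "generator a {} w0"
proof -
  let ?e = "\<lambda>w. \<Sum>j<rk 0. aug j * w j"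
  obtain w0 where w0: "w0 \<in> C 0 a" "?e w0 = 1" using aug_onto assms by blast
  have "w - scal (?e w) w0 \<in> B 0 a {}" if "w \<in> C 0 a" for w
  proof -
    have "?e (scal (?e w) w0) = ?e w * ?e w0"
      by (simp add: scal_apply sum_distrib_left sum_distrib_right mult.left_commute)
    then have "?e (w - scal (?e w) w0) = 0"
      using w0(2) by (simp add: right_diff_distrib sum_subtractf)
    moreover have "w - scal (?e w) w0 \<in> C 0 a" by (intro degree_part_diff degree_part_scal that w0)
    ultimately show ?thesis unfolding B_empty by blast
  qed
  moreover have "w0 \<notin> B 0 b {}" if "shift b {} \<notin> N" for b
    using w0(2) that unfolding B_empty by (simp add: shift_def)
  ultimately have "generator a {} w0"
    unfolding generator_def card.empty Z_empty using w0(1) by blast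
  then show ?thesis by (rule that)
qed

lemma relative_homology_empty: "a \<in> N \<Longrightarrow> Z 0 a {} \<subseteq> B 0 a {}"
  by (auto simp: Z_empty B_empty)

lemma relative_boundary_lower:
  assumes "x \<notin> \<sigma>" "z \<in> B i (lower a x) \<sigma>"
  shows "z \<in> B i a \<sigma>"
proof -
  obtain v r where vr: "v \<in> C (Suc i) (lower a x)" "r \<in> R i (lower a x) \<sigma>" "z = bd (Suc i) v + r"
    using assms(2) unfolding B_iff by blast
  have "r \<in> R i a \<sigma>" using vr(2) R_lower[OF assms(1) R_degree_part[OF vr(2)]] by simp
  then show ?thesis using degree_part_lower[OF vr(1)] vr(3) unfolding B_iff by blast
qed

text \<open>The image of the connecting homomorphism lies in the kernel of multiplication by \<open>x\<close>, because \<open>z\<close>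
in degree \<open>a\<close> is the boundary of \<open>w\<close> up to \<open>(\<sigma>) F\<close>.\<close>

lemma connecting_image_boundary:
  assumes "w \<in> C (Suc i) a" "bd (Suc i) w - z \<in> R i a \<sigma>" "z \<in> C i a"
  shows "z \<in> B i a \<sigma>"
proof -
  have "z - bd (Suc i) w = 0 - (bd (Suc i) w - z)" by (simp add: fun_eq_iff scal_apply)
  also have "\<dots> \<in> R i a \<sigma>" by (intro R_diff R_zero assms)
  finally show ?thesis using assms(1,3) unfolding B_def by blast
qed

text \<open>In homological degree \<open>|\<sigma>| + 1\<close> the connecting homomorphism identifies the homology of
\<open>F/(\<sigma>, x) F\<close> in degree \<open>a\<close> with the kernel of multiplication by \<open>x\<close> from degree \<open>a - e\<^sub>x\<close> to degree
\<open>a\<close> on the homology of \<open>F/(\<sigma>) F\<close> in homological degree \<open>|\<sigma>|\<close>.  The source of that multiplication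
is \<open>0\<close> or a line, so the kernel is \<open>0\<close> or the whole source.\<close>

context
  fixes x :: 'n and \<sigma> :: "'n set" and a :: "'n \<Rightarrow> nat"
  assumes x: "x \<notin> \<sigma>" "0 < a x" and fin: "finite \<sigma>"
begin

lemma connecting_top:
  assumes "w \<in> Z (Suc (card \<sigma>)) a (insert x \<sigma>)"
  obtains z where "z \<in> Z (card \<sigma>) (lower a x) \<sigma>" "bd (Suc (card \<sigma>)) w - z \<in> R (card \<sigma>) a \<sigma>"
    "z \<in> B (card \<sigma>) a \<sigma>"
proof -
  obtain z where z: "z \<in> Z (card \<sigma>) (lower a x) \<sigma>" "bd (Suc (card \<sigma>)) w - z \<in> R (card \<sigma>) a \<sigma>"
    using connecting_exists[OF x(1) assms] .
  have "z \<in> C (card \<sigma>) (lower a x)" "w \<in> C (Suc (card \<sigma>)) a"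
    using z(1) assms unfolding Z_def by blast+
  then have "z \<in> B (card \<sigma>) a \<sigma>"
    using connecting_image_boundary[OF _ z(2)] degree_part_lower[of z _ a x] by blast
  then show ?thesis using that z by blast
qed

lemma boundary_top:
  assumes "w \<in> C (Suc (card \<sigma>)) a" "bd (Suc (card \<sigma>)) w - z \<in> R (card \<sigma>) a \<sigma>"
    "z \<in> B (card \<sigma>) (lower a x) \<sigma>"
  shows "w \<in> B (Suc (card \<sigma>)) a (insert x \<sigma>)"
  by (rule connecting_boundary_conv[where z = z, OF x assms]) (simp add: relative_cycle_boundary fin)

lemma insert_vanishes_if_vanishes:
  assumes "Z (card \<sigma>) (lower a x) \<sigma> \<subseteq> B (card \<sigma>) (lower a x) \<sigma>"
  shows "Z (Suc (card \<sigma>)) a (insert x \<sigma>) \<subseteq> B (Suc (card \<sigma>)) a (insert x \<sigma>)"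
proof
  fix w assume w: "w \<in> Z (Suc (card \<sigma>)) a (insert x \<sigma>)"
  then obtain z where "z \<in> Z (card \<sigma>) (lower a x) \<sigma>" "bd (Suc (card \<sigma>)) w - z \<in> R (card \<sigma>) a \<sigma>"
    by (rule connecting_top)
  moreover have "w \<in> C (Suc (card \<sigma>)) a" using w unfolding Z_def by blast
  ultimately show "w \<in> B (Suc (card \<sigma>)) a (insert x \<sigma>)"
    using assms by (intro boundary_top) auto
qed

text \<open>Here the line in degree \<open>a - e\<^sub>x\<close> survives multiplication by \<open>x\<close>, so the kernel is \<open>0\<close>.\<close>

lemma insert_vanishes_if_injective:
  assumes gen: "generator (lower a x) \<sigma> w0" and "shift a \<sigma> \<notin> N"
  shows "Z (Suc (card \<sigma>)) a (insert x \<sigma>) \<subseteq> B (Suc (card \<sigma>)) a (insert x \<sigma>)"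
proof
  fix w assume w: "w \<in> Z (Suc (card \<sigma>)) a (insert x \<sigma>)"
  then obtain z where z: "z \<in> Z (card \<sigma>) (lower a x) \<sigma>" "bd (Suc (card \<sigma>)) w - z \<in> R (card \<sigma>) a \<sigma>"
    and zB: "z \<in> B (card \<sigma>) a \<sigma>"
    by (rule connecting_top)
  have "\<forall>y\<in>\<sigma>. a y = lower a x y" using x(1) by auto
  then have w0: "w0 \<notin> B (card \<sigma>) a \<sigma>"
    using gen assms(2) lower_le unfolding generator_def by blast
  obtain t where t: "z - scal t w0 \<in> B (card \<sigma>) (lower a x) \<sigma>"
    using gen z(1) unfolding generator_def by blast
  have "z - (z - scal t w0) \<in> B (card \<sigma>) a \<sigma>"
    by (intro B_diff zB relative_boundary_lower[OF x(1) t])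
  moreover have "z - (z - scal t w0) = scal t w0" by (simp add: fun_eq_iff scal_apply)
  ultimately have "scal (inverse t) (scal t w0) \<in> B (card \<sigma>) a \<sigma>" by (simp add: B_scal)
  moreover have "scal (inverse t) (scal t w0) = w0" if "t \<noteq> 0" using that by (simp add: fun_eq_iff scal_apply)
  ultimately have "t = 0" using w0 by metis
  then have "z - scal t w0 = z" by (simp add: fun_eq_iff scal_apply)
  then have "z \<in> B (card \<sigma>) (lower a x) \<sigma>" using t by simp
  moreover have "w \<in> C (Suc (card \<sigma>)) a" using w unfolding Z_def by blast
  ultimately show "w \<in> B (Suc (card \<sigma>)) a (insert x \<sigma>)" using z(2) by (intro boundary_top)
qed

text \<open>Here multiplication by \<open>x\<close> kills the line in degree \<open>a - e\<^sub>x\<close>: a chain \<open>w1\<close> whose boundary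
exhibits this is a preimage of the class of \<open>w0\<close> under the connecting homomorphism.\<close>

lemma insert_generator:
  assumes gen: "generator (lower a x) \<sigma> w0" and "w0 \<in> B (card \<sigma>) a \<sigma>"
  obtains w1 where "generator a (insert x \<sigma>) w1"
proof -
  let ?s = "card \<sigma>"
  obtain w1 where w1: "w1 \<in> C (Suc ?s) a" "w0 - bd (Suc ?s) w1 \<in> R ?s a \<sigma>"
    using assms(2) unfolding B_def by blast
  have "0 - (w0 - bd (Suc ?s) w1) \<in> R ?s a \<sigma>" by (intro R_diff R_zero w1)
  moreover have "0 - (w0 - bd (Suc ?s) w1) = bd (Suc ?s) w1 - w0" by (simp add: fun_eq_iff scal_apply)
  ultimately have w1': "bd (Suc ?s) w1 - w0 \<in> R ?s a \<sigma>" by simp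
  have w0C: "w0 \<in> C ?s (lower a x)" using gen by (simp add: generator_def Z_def)
  have w1Z: "w1 \<in> Z (Suc ?s) a (insert x \<sigma>)"
  proof -
    have "(bd (Suc ?s) w1 - w0) + w0 \<in> R ?s a (insert x \<sigma>)"
      using w1' R_mono[OF subset_insertI] degree_part_lower_R[OF x(2) w0C] by (intro R_add) blast+
    moreover have "(bd (Suc ?s) w1 - w0) + w0 = bd (Suc ?s) w1" by (simp add: fun_eq_iff scal_apply)
    ultimately show ?thesis using w1(1) by (simp add: Z_def)
  qed
  have "\<exists>t. w - scal t w1 \<in> B (Suc ?s) a (insert x \<sigma>)" if w: "w \<in> Z (Suc ?s) a (insert x \<sigma>)" for w
  proof -
    obtain z where z: "z \<in> Z ?s (lower a x) \<sigma>" "bd (Suc ?s) w - z \<in> R ?s a \<sigma>"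
      using connecting_exists[OF x(1) w] .
    obtain t where t: "z - scal t w0 \<in> B ?s (lower a x) \<sigma>"
      using gen z(1) unfolding generator_def by blast
    have "(bd (Suc ?s) w - z) - scal t (bd (Suc ?s) w1 - w0) \<in> R ?s a \<sigma>"
      by (intro R_diff R_scal z w1')
    also have "(bd (Suc ?s) w - z) - scal t (bd (Suc ?s) w1 - w0)
       = bd (Suc ?s) (w - scal t w1) - (z - scal t w0)"
      by (simp add: fun_eq_iff scal_apply bd_diff bd_scal algebra_simps)
    finally have "bd (Suc ?s) (w - scal t w1) - (z - scal t w0) \<in> R ?s a \<sigma>" .
    moreover have "w - scal t w1 \<in> C (Suc ?s) a"
      using w w1(1) unfolding Z_def by (intro degree_part_diff degree_part_scal) blast+
    ultimately show ?thesis using boundary_top t by blast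
  qed
  moreover have "w1 \<notin> B (Suc ?s) b (insert x \<sigma>)"
    if b: "a \<le> b" "\<forall>y\<in>insert x \<sigma>. b y = a y" "shift b (insert x \<sigma>) \<notin> N" for b
  proof
    assume wB: "w1 \<in> B (Suc ?s) b (insert x \<sigma>)"
    have le: "lower a x \<le> lower b x" using b(1,2) by (auto simp: le_fun_def)
    have up: "u \<in> R ?s b \<sigma>" if "u \<in> R ?s a \<sigma>" for u
      using that b(2) degree_part_mono[OF b(1)] by (fastforce simp: R_def)
    have "w0 \<in> B ?s (lower b x) \<sigma>"
    proof (rule connecting_boundary[OF x(1) _ _ _ up[OF w1'] wB])
      show "0 < b x" using b x(2) by simp
      show "w1 \<in> C (Suc ?s) b" using w1(1) degree_part_mono[OF b(1)] by blast
      show "w0 \<in> C ?s (lower b x)" using w0C degree_part_mono[OF le] by blast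
    qed
    moreover have "\<forall>y\<in>\<sigma>. lower b x y = lower a x y" using b(2) x(1) by auto
    moreover have "shift (lower b x) \<sigma> \<notin> N" using b(3) shift_insert[OF x(1), of b] by simp
    ultimately show False using gen le unfolding generator_def by blast
  qed
  ultimately have "generator a (insert x \<sigma>) w1"
    using w1Z unfolding generator_def card_insert_disjoint[OF fin x(1)] by blast
  then show ?thesis by (rule that)
qed

end

text \<open>In homological degree \<open>|\<sigma>|\<close> the homology of \<open>F/(\<sigma>) F\<close> is the part of \<open>S/M\<close> killed by the variables
in \<open>\<sigma>\<close>, moved up by the degree of their product.  Adding \<open>x\<close> to \<open>\<sigma>\<close> takes the kernel of
multiplication by \<open>x\<close> on both sides.\<close>

lemma relative_homology_top:
  assumes "finite \<sigma>"
  shows "(\<not> socle_at N \<sigma> a \<longrightarrow> Z (card \<sigma>) a \<sigma> \<subseteq> B (card \<sigma>) a \<sigma>) \<and>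
    (socle_at N \<sigma> a \<longrightarrow> (\<exists>w0. generator a \<sigma> w0))"
  using assms
proof (induction \<sigma> arbitrary: a rule: finite_induct)
  case empty
  have "socle_at N {} a \<longleftrightarrow> a \<notin> N" by (simp add: socle_at_def shift_def)
  then show ?case
    using relative_homology_empty[of a] generator_empty[of a] by (metis card.empty)
next
  case (insert x \<sigma>)
  note soc = socle_at_insert[OF insert.hyps(2), of a]
    and card = card_insert_disjoint[OF insert.hyps]
  consider "a x = 0" | "0 < a x" "\<not> socle_at N \<sigma> (lower a x)"
    | "0 < a x" "socle_at N \<sigma> (lower a x)" "shift a \<sigma> \<notin> N"
    | "0 < a x" "socle_at N \<sigma> (lower a x)" "shift a \<sigma> \<in> N" by blast
  then show ?case
  proof cases
    case 1
    then show ?thesis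
      using relative_cycle_boundary[OF insert.hyps(1), of "Suc (card \<sigma>)" a] soc
      unfolding card Z_insert_zero[of a x, OF 1] B_insert_zero[of a x, OF 1] by simp
  next
    case 2
    then have "Z (card \<sigma>) (lower a x) \<sigma> \<subseteq> B (card \<sigma>) (lower a x) \<sigma>" using insert.IH by blast
    then show ?thesis
      using insert_vanishes_if_vanishes[of x \<sigma> a, OF insert.hyps(2) 2(1) insert.hyps(1)] 2 soc unfolding card by blast
  next
    case 3
    then obtain w0 where "generator (lower a x) \<sigma> w0" using insert.IH by blast
    then show ?thesis
      using insert_vanishes_if_injective[of x \<sigma> a, OF insert.hyps(2) 3(1) insert.hyps(1)] 3 soc unfolding card by blast
  next
    case 4
    then obtain w0 where w0: "generator (lower a x) \<sigma> w0" using insert.IH by blast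
    then have "w0 \<in> Z (card \<sigma>) (lower a x) \<sigma>" by (simp add: generator_def)
    then have "w0 \<in> Z (card \<sigma>) a \<sigma>" by (rule Z_lower[OF insert.hyps(2)])
    moreover have "\<not> socle_at N \<sigma> a" using 4 by (simp add: socle_at_def)
    ultimately have "w0 \<in> B (card \<sigma>) a \<sigma>" using insert.IH by blast
    then have "\<exists>w1. generator a (insert x \<sigma>) w1"
      using insert_generator[of x \<sigma> a, OF insert.hyps(2) 4(1) insert.hyps(1) w0] by blast
    then show ?thesis using 4 soc by blast
  qed
qed

section \<open>The ranks of a minimal resolution from the number of variables on\<close>

text \<open>In degree \<open>a\<close> only the basis elements of degree exactly \<open>a\<close> survive modulo all variables, and by
minimality no differential connects two of them.  So every chain is a cycle, as \<open>Z_UNIV\<close> says,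
and the boundaries are the chains that vanish at these basis elements.\<close>

lemma boundary_entry_zero:
  assumes "w \<in> B i a UNIV" "dg i j = a" 
  shows "w j = 0"
proof (rule ccontr)
  assume nz: "w j \<noteq> 0"
  obtain v r where vr: "v \<in> C (Suc i) a" "r \<in> R i a UNIV" "w = bd (Suc i) v + r"
    using assms by (auto simp: B_iff)
  have "r j = 0" using vr(2) assms(2) by (auto simp: R_def)
  then have "bd (Suc i) v j \<noteq> 0" using nz vr(3) by simp
  then obtain q where q: "j < rk i" "q < rk (Suc i)" "c i j q \<noteq> 0" "v q \<noteq> 0"
    by (auto simp: bd_def elim: mat_vec_nonzeroD)
  then have "dg i j \<le> dg (Suc i) q" "dg (Suc i) q \<le> a"
    using graded[of i] vr(1) by (auto simp: graded_matrix_def degree_part_def)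
  then have "dg i j = dg (Suc i) q" using assms(2) by simp
  then show False using minimal q by blast
qed

lemma boundary_UNIV_I:
  assumes "w \<in> C i a" "\<And>j. j < rk i \<Longrightarrow> dg i j = a \<Longrightarrow> w j = 0"
  shows "w \<in> B i a UNIV"
proof -
  have "w \<in> R i a UNIV"
  proof -
    have "\<exists>x. dg i j x < a x" if "w j \<noteq> 0" for j
    proof -
      have "dg i j \<le> a" "dg i j \<noteq> a" using assms that by (auto simp: degree_part_def)
      then show ?thesis by (auto simp: le_fun_def fun_eq_iff scal_apply) (metis order_le_less)
    qed
    then show ?thesis using assms(1) by (auto simp: R_def)
  qed
  then have "w - bd (Suc i) 0 \<in> R i a UNIV" by (simp add: bd_zero)
  then show ?thesis using assms(1) degree_part_zero unfolding B_def by blast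
qed

lemma Z_UNIV: "Z i a UNIV = C i a"
proof -
  have "bd i w \<in> R (i - 1) a UNIV" if w: "w \<in> C i a" for w
  proof (cases i)
    case 0
    then show ?thesis by (simp add: bd_def R_zero)
  next
    case (Suc l)
    have "\<exists>x. dg l p x < a x" if "bd i w p \<noteq> 0" for p
    proof -
      from that obtain q where q: "p < rk l" "q < rk i" "c l p q \<noteq> 0" "w q \<noteq> 0"
        by (auto simp: bd_def Suc elim: mat_vec_nonzeroD)
      then have "dg l p \<le> dg i q" "dg l p \<noteq> dg i q" "dg i q \<le> a"
        using graded[of l] minimal[of p l q] w Suc by (auto simp: graded_matrix_def degree_part_def)
      then have "\<not> a \<le> dg l p" by order
      then show ?thesis by (simp add: le_fun_def not_le)
    qed
    then show ?thesis using bd_degree_part[of w l a] w Suc by (auto simp: R_def)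
  qed
  then show ?thesis by (auto simp: Z_def)
qed

lemma unit_vec_degree_part: "j < rk i \<Longrightarrow> unit_vec j \<in> C i (dg i j)"
  by (simp add: unit_vec_def degree_part_def)

lemma rank_beyond_zero:
  assumes "CARD('n) < i"
  shows "rk i = 0"
proof (rule ccontr)
  assume "rk i \<noteq> 0"
  then have "unit_vec 0 \<in> Z i (dg i 0) UNIV" by (simp add: Z_UNIV unit_vec_degree_part)
  then have "unit_vec 0 \<in> B i (dg i 0) UNIV" using relative_cycle_boundary[of UNIV i] assms by auto
  then have "unit_vec 0 0 = (0 :: 'k)" by (rule boundary_entry_zero) simp
  then show False by (simp add: unit_vec_def)
qed

text \<open>Since \<open>F/(x\<^sub>1, \<dots>, x\<^sub>n) F\<close> has zero differential, the number of basis elements of degree \<open>a\<close> in \<open>F\<^sub>n\<close>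
is the dimension of its homology in that degree, which is \<open>1\<close> or \<open>0\<close> according to \<open>socle_at\<close>.\<close>

lemma rank_top:
  "bij_betw (dg CARD('n)) {..<rk CARD('n)} {a. socle_at N UNIV a}"
proof -
  let ?n = "CARD('n)"
  have soc: "socle_at N UNIV (dg ?n j)" if "j < rk ?n" for j
  proof (rule ccontr)
    assume "\<not> socle_at N UNIV (dg ?n j)"
    then have "Z ?n (dg ?n j) UNIV \<subseteq> B ?n (dg ?n j) UNIV"
      using relative_homology_top[of UNIV "dg ?n j"] by simp
    then have "unit_vec j \<in> B ?n (dg ?n j) UNIV"
      using unit_vec_degree_part[OF that] by (auto simp: Z_UNIV)
    then have "unit_vec j j = (0 :: 'k)" by (rule boundary_entry_zero) simp
    then show False by (simp add: unit_vec_def)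
  qed
  have ex: "\<exists>w0\<in>C ?n a. (\<forall>w\<in>C ?n a. \<exists>t. w - scal t w0 \<in> B ?n a UNIV) \<and> w0 \<notin> B ?n a UNIV"
    if "socle_at N UNIV a" for a
  proof -
    have "shift a UNIV \<notin> N" using that by (simp add: socle_at_def)
    then show ?thesis using relative_homology_top[of UNIV a] that
      unfolding generator_def Z_UNIV by (metis finite order_refl)
  qed
  \<comment> \<open>two basis elements of the same degree would be independent in a homology space spanned by one class\<close>
  have "inj_on (dg ?n) {..<rk ?n}"
  proof (rule inj_onI, rule ccontr)
    fix j l assume jl: "j \<in> {..<rk ?n}" "l \<in> {..<rk ?n}" "dg ?n j = dg ?n l" "j \<noteq> l"
    let ?a = "dg ?n j"
    obtain w0 where w0: "\<And>w. w \<in> C ?n ?a \<Longrightarrow> \<exists>t. w - scal t w0 \<in> B ?n ?a UNIV"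
      using ex[of ?a] soc[of j] jl(1) by auto
    have "unit_vec j \<in> C ?n ?a" "unit_vec l \<in> C ?n ?a" using unit_vec_degree_part[of j ?n] unit_vec_degree_part[of l ?n] jl by auto
    then obtain t u where "unit_vec j - scal t w0 \<in> B ?n ?a UNIV" "unit_vec l - scal u w0 \<in> B ?n ?a UNIV"
      using w0 by blast
    then have "(unit_vec j - scal t w0) j = 0" "(unit_vec j - scal t w0) l = 0"
      "(unit_vec l - scal u w0) j = 0" "(unit_vec l - scal u w0) l = 0"
      using boundary_entry_zero jl(3) by metis+
    then show False using jl(4) by (auto simp: unit_vec_def scal_apply)
  qed
  moreover have "a \<in> dg ?n ` {..<rk ?n}" if a: "socle_at N UNIV a" for a
  proof (rule ccontr)
    assume no: "a \<notin> dg ?n ` {..<rk ?n}"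
    obtain w0 where "w0 \<in> C ?n a" "w0 \<notin> B ?n a UNIV" using ex[OF a] by auto
    then show False using boundary_UNIV_I[of w0 ?n a] no by blast
  qed
  ultimately show ?thesis using soc by (auto simp: bij_betw_def)
qed

end

interpretation vec: vector_space "scal :: 'k::field \<Rightarrow> _"
  by standard (auto simp: fun_eq_iff scal_apply algebra_simps)

lemma sum_fun_apply: "(\<Sum>q\<in>A. f q) p = (\<Sum>q\<in>A. f q p)"
  for f :: "'a \<Rightarrow> 'b \<Rightarrow> 'c::comm_monoid_add"
  by (induction A rule: infinite_finite_induct) auto

section \<open>Dickson's lemma and generators of multigraded submodules\<close>

text \<open>A decreasing sequence of natural numbers is eventually constant, so the monotone subsequence that
every sequence has can be taken to be increasing.\<close>

lemma increasing_subsequence: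
  fixes t :: "nat \<Rightarrow> nat"
  obtains g where "strict_mono g" "incseq (t \<circ> g)"
proof -
  obtain f where f: "strict_mono f" "monoseq (\<lambda>n. t (f n))"
    using seq_monosub[of t] by blast
  show ?thesis
  proof (cases "incseq (\<lambda>n. t (f n))")
    case True
    then show ?thesis using that f by (simp add: comp_def)
  next
    case False
    then have dec: "decseq (\<lambda>n. t (f n))" using f(2) by (simp add: monoseq_iff)
    define m where "m = (LEAST v. v \<in> range (\<lambda>n. t (f n)))"
    have "m \<in> range (\<lambda>n. t (f n))" unfolding m_def by (rule LeastI[of _ "t (f 0)"]) auto
    then obtain k where k: "t (f k) = m" by auto
    have "t (f n) = m" if "k \<le> n" for n
    proof (rule antisym)
      show "t (f n) \<le> m" using decseqD[OF dec that] k by simp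
      show "m \<le> t (f n)" unfolding m_def by (rule Least_le) auto
    qed
    then have "incseq (t \<circ> (\<lambda>i. f (k + i)))" by (simp add: comp_def incseq_def)
    moreover have "strict_mono (\<lambda>i. f (k + i))" using f(1) by (simp add: strict_mono_def)
    ultimately show ?thesis using that by blast
  qed
qed

text \<open>Passing to increasing subsequences for one coordinate after the other.\<close>

lemma dickson:
  fixes s :: "nat \<Rightarrow> 'n::finite \<Rightarrow> nat"
  obtains f where "strict_mono f" "incseq (s \<circ> f)"
proof -
  have "\<exists>f. strict_mono f \<and> (\<forall>x\<in>X. incseq (\<lambda>i. s (f i) x))" for X :: "'n set"
    using finite[of X]
  proof (induction X rule: finite_induct)
    case empty
    then show ?case by (intro exI[of _ id]) (simp add: strict_mono_def)
  next
    case (insert y X)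
    then obtain f where f: "strict_mono f" "\<forall>x\<in>X. incseq (\<lambda>i. s (f i) x)" by blast
    obtain g where g: "strict_mono g" "incseq ((\<lambda>i. s (f i) y) \<circ> g)"
      by (rule increasing_subsequence)
    have "incseq (\<lambda>i. s (f (g i)) x)" if "x \<in> X" for x
      using f(2) g(1) that by (auto simp: incseq_def strict_mono_less_eq)
    then show ?case using g f(1)
      by (intro exI[of _ "f \<circ> g"]) (auto simp: comp_def strict_mono_def)
  qed
  from this[of UNIV] show ?thesis using that by (auto simp: incseq_def le_fun_def)
qed

text \<open>A multigraded submodule of a free module, given by its degree parts.  The last clause says that it
is contained in \<open>(x\<^sub>1, \<dots>, x\<^sub>n)\<close> times the free module: in degree \<open>a\<close> a basis element of
degree \<open>a\<close> could only have a nonzero constant as coefficient.\<close>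

definition syzygy_family ::
  "nat \<Rightarrow> (nat \<Rightarrow> 'n \<Rightarrow> nat) \<Rightarrow> (('n \<Rightarrow> nat) \<Rightarrow> (nat \<Rightarrow> 'k::field) set) \<Rightarrow> bool" where
  "syzygy_family r d V \<longleftrightarrow>
     (\<forall>a. vec.subspace (V a) \<and> V a \<subseteq> degree_part r d a) \<and>
     (\<forall>a b. a \<le> b \<longrightarrow> V a \<subseteq> V b) \<and>
     (\<forall>a. \<forall>w\<in>V a. \<forall>j. w j \<noteq> 0 \<longrightarrow> d j \<noteq> a)"

text \<open>The degree \<open>a\<close> part of \<open>(x\<^sub>1, \<dots>, x\<^sub>n) V\<close>, since multiplication by monomials is inclusion.\<close>

definition below :: "(('n \<Rightarrow> nat) \<Rightarrow> (nat \<Rightarrow> 'k::field) set) \<Rightarrow> ('n \<Rightarrow> nat) \<Rightarrow> (nat \<Rightarrow> 'k) set" where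
  "below V a = vec.span (\<Union>b\<in>{b. b < a}. V b)"

lemma degree_part_subset_span: "degree_part r d a \<subseteq> vec.span (unit_vec ` {..<r})"
proof
  fix w :: "nat \<Rightarrow> 'k::field" assume w: "w \<in> degree_part r d a"
  have "w = (\<Sum>j<r. scal (w j) (unit_vec j))"
  proof
    fix l
    have "(\<Sum>j<r. w j * unit_vec j l) = (\<Sum>j<r. if j = l then w l else 0)"
      by (intro sum.cong) (auto simp: unit_vec_def scal_apply)
    also have "\<dots> = w l" using w by (auto simp: degree_part_def)
    finally show "w l = (\<Sum>j<r. scal (w j) (unit_vec j)) l" by (simp add: sum_fun_apply scal_apply)
  qed
  then show "w \<in> vec.span (unit_vec ` {..<r})"
    by (metis (no_types, lifting) image_eqI vec.span_base vec.span_scale vec.span_sum)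
qed

lemma independent_degree_part:
  fixes S :: "(nat \<Rightarrow> 'k::field) set"
  assumes "vec.independent S" "S \<subseteq> degree_part r d a"
  shows "finite S \<and> card S \<le> r"
proof -
  have "finite S \<and> card S \<le> card (unit_vec ` {..<r} :: (nat \<Rightarrow> 'k) set)"
    using assms degree_part_subset_span[of r d a] by (intro vec.independent_span_bound) auto
  then show ?thesis using card_image_le[of "{..<r}" "unit_vec :: nat \<Rightarrow> nat \<Rightarrow> 'k"] by simp
qed

text \<open>Infinitely many degrees with new generators would contain an increasing sequence of degrees by
Dickson's lemma.  New elements \<open>v i\<close> along this sequence are linearly independent, as each lies
outside the span of everything in smaller degrees; but they all live in a space of dimension \<open>r\<close>.
This replaces the Hilbert basis theorem.\<close>

lemma finitely_many_generator_degrees: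
  fixes V :: "('n::finite \<Rightarrow> nat) \<Rightarrow> (nat \<Rightarrow> 'k::field) set"
  assumes V: "syzygy_family r d V"
  shows "finite {a. \<not> V a \<subseteq> below V a}"
proof (rule ccontr)
  assume "infinite {a. \<not> V a \<subseteq> below V a}"
  then obtain s :: "nat \<Rightarrow> 'n \<Rightarrow> nat" where s: "inj s" "range s \<subseteq> {a. \<not> V a \<subseteq> below V a}"
    by (metis infinite_iff_countable_subset)
  obtain f where f: "strict_mono f" "incseq (s \<circ> f)" by (rule dickson)
  define a where "a = s \<circ> f"
  have a_less: "a i < a j" if "i < j" for i j
  proof -
    have "a i \<le> a j" using f(2) that by (auto simp: a_def incseq_def)
    moreover have "a i \<noteq> a j" using s(1) f(1) that by (auto simp: a_def inj_eq strict_mono_eq)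
    ultimately show ?thesis by simp
  qed
  have "\<forall>i. \<exists>v. v \<in> V (a i) \<and> v \<notin> below V (a i)" using s(2) by (auto simp: a_def)
  then obtain v where v: "\<And>i. v i \<in> V (a i)" "\<And>i. v i \<notin> below V (a i)" by metis
  have ind: "vec.independent (v ` {..<m}) \<and> card (v ` {..<m}) = m" for m
  proof (induction m)
    case 0
    show ?case unfolding lessThan_0 image_empty card.empty by (intro conjI vec.independent_empty refl)
  next
    case (Suc m)
    have "v ` {..<m} \<subseteq> (\<Union>b\<in>{b. b < a m}. V b)" using a_less v(1) by blast
    then have "v m \<notin> vec.span (v ` {..<m})"
      using v(2)[of m] vec.span_mono[of "v ` {..<m}" "\<Union>b\<in>{b. b < a m}. V b"]
      unfolding below_def by blast
    moreover from this have "v m \<notin> v ` {..<m}" using vec.span_base[of "v m" "v ` {..<m}"] by blast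
    moreover have "vec.independent (insert (v m) (v ` {..<m}))"
      using Suc calculation(1) by (intro vec.independent_insertI) auto
    ultimately show ?case using Suc unfolding lessThan_Suc image_insert by simp
  qed
  have "v ` {..<Suc r} \<subseteq> degree_part r d (a r)"
  proof
    fix w assume "w \<in> v ` {..<Suc r}"
    then obtain i where "i \<le> r" "w = v i" by (auto simp: less_Suc_eq_le)
    moreover have "a i \<le> a r" using f(2) \<open>i \<le> r\<close> by (auto simp: a_def incseq_def)
    ultimately show "w \<in> degree_part r d (a r)" using v(1)[of i] V unfolding syzygy_family_def by blast
  qed
  then show False using independent_degree_part ind[of "Suc r"] by fastforce
qed

text \<open>\<open>Y\<close> is a set of minimal generators in degree \<open>a\<close>: it completes a basis \<open>X\<close> of what is generated
from smaller degrees.\<close>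

lemma new_generators:
  assumes V: "syzygy_family r d V"
  obtains X Y where "vec.span X = below V a" "vec.independent (X \<union> Y)" "X \<inter> Y = {}" "finite Y"
    "Y \<subseteq> V a" "V a \<subseteq> vec.span (X \<union> Y)"
proof -
  have "V b \<subseteq> V a" if "b < a" for b
    using V less_imp_le[OF that] unfolding syzygy_family_def by blast
  moreover have "vec.subspace (V a)" using V unfolding syzygy_family_def by blast
  ultimately have sub: "below V a \<subseteq> V a"
    unfolding below_def by (intro vec.span_minimal) auto
  obtain X where X: "X \<subseteq> below V a" "vec.independent X" "below V a \<subseteq> vec.span X"
    by (rule vec.maximal_independent_subset)
  obtain Y where Y: "X \<subseteq> Y" "Y \<subseteq> V a" "vec.independent Y" "V a \<subseteq> vec.span Y"
    using vec.maximal_independent_subset_extend[of X "V a"] X sub by blast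
  have "Y \<subseteq> degree_part r d a" using Y(2) V unfolding syzygy_family_def by blast
  then have "finite Y" using independent_degree_part[OF Y(3)] by blast
  moreover have "vec.span X = below V a"
    using X(1,3) unfolding below_def by (metis antisym vec.span_minimal vec.subspace_span)
  moreover have "X \<union> (Y - X) = Y" using Y(1) by blast
  ultimately show ?thesis using that[of X "Y - X"] Y by auto
qed

section \<open>Existence of minimal resolutions\<close>

text \<open>The columns of \<open>c\<close> generate \<open>V\<close>, and no entry of \<open>c\<close> corresponds to a nonzero constant.\<close>

definition minimal_presentation ::
  "nat \<Rightarrow> (nat \<Rightarrow> 'n \<Rightarrow> nat) \<Rightarrow> (('n \<Rightarrow> nat) \<Rightarrow> (nat \<Rightarrow> 'k::field) set)
    \<Rightarrow> nat \<Rightarrow> (nat \<Rightarrow> 'n \<Rightarrow> nat) \<Rightarrow> (nat \<Rightarrow> nat \<Rightarrow> 'k) \<Rightarrow> bool" where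
  "minimal_presentation r d V s d' c \<longleftrightarrow>
     graded_matrix r s d d' c \<and> (\<forall>p<r. \<forall>q<s. c p q \<noteq> 0 \<longrightarrow> d p \<noteq> d' q) \<and>
     (\<forall>a. V a = mat_vec r s c ` degree_part s d' a)"

abbreviation kernel_family where
  "kernel_family r s d' c \<equiv> (\<lambda>a. {w \<in> degree_part s d' a. mat_vec r s c w = 0})"

lemma degree_sum_less: "b < a \<Longrightarrow> sum b UNIV < sum a UNIV" for a b :: "'n::finite \<Rightarrow> nat"
  by (rule sum_strict_mono_ex1) (auto simp: less_le_not_le[of b a] le_fun_def not_le)

text \<open>The columns of \<open>c\<close> are the minimal generators from \<open>new_generators\<close> in all of the finitely many
degrees in which there are any.  They generate by induction on the degree.  A relation in which a
generator of degree \<open>a\<close> occurs with nonzero coefficient in degree \<open>a\<close> would express it through the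
other generators of degree \<open>a\<close> and \<open>below V a\<close>, contradicting independence; hence the relations
again form a syzygy family, and the construction can be repeated.\<close>

lemma minimal_presentation_exists:
  fixes V :: "('n::finite \<Rightarrow> nat) \<Rightarrow> (nat \<Rightarrow> 'k::field) set"
  assumes V: "syzygy_family r d V"
  obtains s d' c where "minimal_presentation r d V s d' c" "syzygy_family s d' (kernel_family r s d' c)"
proof -
  have "\<exists>X Y. vec.span X = below V a \<and> vec.independent (X \<union> Y) \<and> X \<inter> Y = {} \<and> finite Y \<and>
    Y \<subseteq> V a \<and> V a \<subseteq> vec.span (X \<union> Y)" for a
    by (rule new_generators[OF V, of a]) blast
  then obtain X Y where XY: "\<And>a. vec.span (X a) = below V a" "\<And>a. vec.independent (X a \<union> Y a)"
      "\<And>a. X a \<inter> Y a = {}" "\<And>a. finite (Y a)" "\<And>a. Y a \<subseteq> V a" "\<And>a. V a \<subseteq> vec.span (X a \<union> Y a)"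
    by metis
  have sub: "vec.subspace (V a)" "V a \<subseteq> degree_part r d a" for a
    using V by (auto simp: syzygy_family_def)
  have mono: "a \<le> b \<Longrightarrow> V a \<subseteq> V b" for a b using V by (auto simp: syzygy_family_def)
  \<comment> \<open>\<open>P\<close> lists every generator together with its degree, as one vector may serve in several degrees\<close>
  define P where "P = Sigma {a. \<not> V a \<subseteq> below V a} Y"
  have PI: "(a, y) \<in> P" if "y \<in> Y a" for a y
  proof -
    have "X a \<subseteq> X a \<union> Y a - {y}" using XY(3)[of a] that by auto
    then have "y \<notin> vec.span (X a)"
      using XY(2)[of a] that vec.span_mono[of "X a" "X a \<union> Y a - {y}"] unfolding vec.dependent_def by blast
    then show ?thesis using that XY(1)[of a] XY(5)[of a] unfolding P_def by blast
  qed
  have "finite P"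
    unfolding P_def using finitely_many_generator_degrees[OF V] XY(4) by (intro finite_SigmaI) auto
  then obtain h where h: "bij_betw h {..<card P} P"
    using ex_bij_betw_nat_finite[of P] by (auto simp: atLeast0LessThan)
  define s where "s = card P"
  define d' where "d' = fst \<circ> h"
  define col where "col = snd \<circ> h"
  define c where "c = (\<lambda>p q. col q p)"
  have hP: "col q \<in> Y (d' q)" if "q < s" for q
    using bij_betwE[OF h] that by (force simp: P_def s_def d'_def col_def)
  have hinj: "q = q'" if "q < s" "q' < s" "d' q = d' q'" "col q = col q'" for q q'
    using bij_betw_imp_inj_on[OF h] that by (auto simp: s_def d'_def col_def inj_on_def prod_eq_iff)
  have hsurj: "\<exists>q<s. d' q = a \<and> col q = y" if "y \<in> Y a" for a y
  proof -
    have "(a, y) \<in> h ` {..<s}" using bij_betw_imp_surj_on[OF h] PI[OF that] by (simp add: s_def)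
    then obtain q where "q < s" "h q = (a, y)" by auto
    then show ?thesis by (intro exI[of _ q]) (simp add: d'_def col_def)
  qed
  have colV: "col q \<in> V a" if "q < s" "d' q \<le> a" for q a
    using hP[OF that(1)] XY(5) mono[OF that(2)] by blast
  have mv: "mat_vec r s c w = (\<Sum>q<s. scal (w q) (col q))" for w
  proof
    fix p
    have "col q p = 0" if "q < s" "\<not> p < r" for q
      using colV[OF that(1) order_refl] sub(2) that(2) by (auto simp: degree_part_def)
    then show "mat_vec r s c w p = (\<Sum>q<s. scal (w q) (col q)) p"
      by (simp add: mat_vec_def sum_fun_apply scal_apply c_def mult.commute)
  qed
  have gen: "V a \<subseteq> vec.span {col q |q. q < s \<and> d' q \<le> a}" for a
  proof (induction a rule: measure_induct_rule[where f = "\<lambda>a. sum a UNIV"])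
    case (less a)
    let ?S = "\<lambda>a. {col q |q. q < s \<and> d' q \<le> a}"
    have "V b \<subseteq> vec.span (?S a)" if "b < a" for b
    proof -
      have "?S b \<subseteq> ?S a" using that by (auto intro: order_trans less_imp_le)
      then show ?thesis using less.IH[OF degree_sum_less[OF that]] vec.span_mono[of "?S b" "?S a"] by blast
    qed
    then have "below V a \<subseteq> vec.span (?S a)"
      unfolding below_def by (intro vec.span_minimal) (auto simp: vec.subspace_span)
    then have "X a \<subseteq> vec.span (?S a)" using XY(1)[of a] vec.span_superset by blast
    moreover have "Y a \<subseteq> ?S a" using hsurj by fastforce
    then have "Y a \<subseteq> vec.span (?S a)" using vec.span_superset by blast
    ultimately have "vec.span (X a \<union> Y a) \<subseteq> vec.span (?S a)"
      by (intro vec.span_minimal) (auto simp: vec.subspace_span)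
    then show ?case using XY(6) by blast
  qed
  have image: "V a = mat_vec r s c ` degree_part s d' a" for a
  proof
    have "vec.subspace (mat_vec r s c ` degree_part s d' a)"
      unfolding vec.subspace_def
    proof (intro conjI ballI allI)
      show "0 \<in> mat_vec r s c ` degree_part s d' a"
        by (rule image_eqI[of _ _ 0]) (simp_all add: degree_part_zero)
      fix u v assume uv: "u \<in> mat_vec r s c ` degree_part s d' a"
      then show "scal t u \<in> mat_vec r s c ` degree_part s d' a" for t
        by (auto simp: mat_vec_scal[symmetric] degree_part_scal)
      assume "v \<in> mat_vec r s c ` degree_part s d' a"
      then show "u + v \<in> mat_vec r s c ` degree_part s d' a"
        using uv by (auto simp: mat_vec_add[symmetric] degree_part_add)
    qed
    moreover have "col q \<in> mat_vec r s c ` degree_part s d' a" if q: "q < s" "d' q \<le> a" for q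
    proof (rule image_eqI[of _ _ "unit_vec q"])
      show "unit_vec q \<in> degree_part s d' a" using q by (simp add: unit_vec_def degree_part_def)
      have "(\<Sum>l<s. scal (unit_vec q l) (col l)) = (\<Sum>l<s. if l = q then col q else 0)"
        by (intro sum.cong) (auto simp: unit_vec_def fun_eq_iff scal_apply)
      then show "col q = mat_vec r s c (unit_vec q)" using q by (simp add: mv)
    qed
    ultimately show "V a \<subseteq> mat_vec r s c ` degree_part s d' a"
      using gen[of a] vec.span_minimal[of "{col q |q. q < s \<and> d' q \<le> a}"] by blast
  next
    show "mat_vec r s c ` degree_part s d' a \<subseteq> V a"
    proof
      fix v assume "v \<in> mat_vec r s c ` degree_part s d' a"
      then obtain w where w: "w \<in> degree_part s d' a" "v = (\<Sum>q<s. scal (w q) (col q))" by (auto simp: mv)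
      have "scal (w q) (col q) \<in> V a" if "q < s" for q
      proof (cases "w q = 0")
        case True
        then show ?thesis by (simp add: vec.subspace_0[OF sub(1)])
      next
        case False
        then have "d' q \<le> a" using w(1) by (auto simp: degree_part_def)
        then show ?thesis using colV that vec.subspace_scale[OF sub(1)] by blast
      qed
      then show "v \<in> V a" unfolding w(2) by (intro vec.subspace_sum[OF sub(1)]) auto
    qed
  qed
  have "minimal_presentation r d V s d' c"
  proof -
    have "d p \<le> d' q \<and> d p \<noteq> d' q" if "q < s" "c p q \<noteq> 0" for p q
    proof -
      have "col q \<in> V (d' q)" "col q p \<noteq> 0" using colV that by (auto simp: c_def)
      then show ?thesis using V unfolding syzygy_family_def degree_part_def by blast
    qed
    then show ?thesis using image by (simp add: minimal_presentation_def graded_matrix_def)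
  qed
  moreover have "syzygy_family s d' (kernel_family r s d' c)"
    unfolding syzygy_family_def
  proof (intro conjI allI impI ballI)
    fix a b :: "'n \<Rightarrow> nat"
    have "scal t 0 = (0 :: nat \<Rightarrow> 'k)" for t by (simp add: fun_eq_iff scal_apply)
    then show "vec.subspace (kernel_family r s d' c a)"
      by (auto simp: vec.subspace_def degree_part_zero degree_part_add degree_part_scal mat_vec_add mat_vec_scal)
    show "kernel_family r s d' c a \<subseteq> degree_part s d' a" by blast
    show "kernel_family r s d' c a \<subseteq> kernel_family r s d' c b" if "a \<le> b"
      using degree_part_mono[OF that] by blast
    fix w j assume w: "w \<in> kernel_family r s d' c a" and j: "w j \<noteq> 0"
    show "d' j \<noteq> a"
    proof
      assume da: "d' j = a"
      have js: "j < s" using w j by (auto simp: degree_part_def)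
      let ?S = "X a \<union> Y a - {col j}"
      have jX: "col j \<notin> X a" "col j \<in> Y a" using hP[OF js] XY(3)[of a] da by auto
      have other: "scal (w q) (col q) \<in> vec.span ?S" if q: "q \<in> {..<s} - {j}" for q
      proof (cases "w q = 0")
        case True
        then show ?thesis by (simp add: vec.span_zero)
      next
        case False
        then have le: "d' q \<le> a" using w by (auto simp: degree_part_def)
        have "col q \<in> vec.span ?S"
        proof (cases "d' q = a")
          case True
          then have "col q \<in> Y a" "col q \<noteq> col j" using hP[of q] hinj[of q j] q js da by auto
          then show ?thesis by (intro vec.span_base) auto
        next
          case False
          then have "d' q < a" using le by order
          then have "col q \<in> below V a"
            using q colV[of q "d' q"] unfolding below_def by (intro vec.span_base) auto
          moreover have "X a \<subseteq> ?S" using jX by auto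
          ultimately show ?thesis using XY(1)[of a] vec.span_mono[of "X a" ?S] by blast
        qed
        then show ?thesis by (rule vec.span_scale)
      qed
      have "0 = (\<Sum>q<s. scal (w q) (col q))" using w by (simp add: mv)
      also have "\<dots> = scal (w j) (col j) + (\<Sum>q\<in>{..<s} - {j}. scal (w q) (col q))"
        using js by (intro sum.remove) auto
      finally have "scal (w j) (col j) = - (\<Sum>q\<in>{..<s} - {j}. scal (w q) (col q))"
        by (simp add: eq_neg_iff_add_eq_0)
      moreover have "(\<Sum>q\<in>{..<s} - {j}. scal (w q) (col q)) \<in> vec.span ?S"
        by (rule vec.span_sum) (rule other)
      ultimately have "scal (w j) (col j) \<in> vec.span ?S" by (simp add: vec.span_neg)
      then have "scal (inverse (w j)) (scal (w j) (col j)) \<in> vec.span ?S" by (rule vec.span_scale)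
      moreover have "scal (inverse (w j)) (scal (w j) (col j)) = col j"
        using j by (simp add: fun_eq_iff scal_apply)
      ultimately have "col j \<in> vec.span ?S" by simp
      then show False using XY(2)[of a] jX(2) unfolding vec.dependent_def by blast
    qed
  qed
  ultimately show ?thesis using that by blast
qed

lemma iterated_presentation:
  fixes V :: "('n::finite \<Rightarrow> nat) \<Rightarrow> (nat \<Rightarrow> 'k::field) set"
  assumes V: "syzygy_family r d V"
  obtains rk dg c where "rk 0 = r" "dg 0 = d"
    "minimal_presentation r d V (rk 1) (dg 1) (c 0)"
    "\<And>i. minimal_presentation (rk (Suc i)) (dg (Suc i))
      (kernel_family (rk i) (rk (Suc i)) (dg (Suc i)) (c i)) (rk (Suc (Suc i))) (dg (Suc (Suc i))) (c (Suc i))"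
proof -
  let ?P = "\<lambda>n (r', d', V'). syzygy_family r' d' V' \<and> (n = (0::nat) \<longrightarrow> r' = r \<and> d' = d \<and> V' = V)"
  let ?Q = "\<lambda>n (r', d', V') (s, e, W). \<exists>c. minimal_presentation r' d' V' s e c \<and> W = kernel_family r' s e c"
  have "\<exists>f. \<forall>n. ?P n (f n) \<and> ?Q n (f n) (f (Suc n))"
  proof (rule dependent_nat_choice)
    show "\<exists>x. ?P 0 x" using V by (intro exI[of _ "(r, d, V)"]) simp
    fix x n assume "?P n x"
    moreover obtain r' d' V' where x: "x = (r', d', V')" by (cases x)
    ultimately have "syzygy_family r' d' V'" by simp
    then obtain s e c where "minimal_presentation r' d' V' s e c" "syzygy_family s e (kernel_family r' s e c)"
      by (rule minimal_presentation_exists)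
    then show "\<exists>y. ?P (Suc n) y \<and> ?Q n x y"
      by (intro exI[of _ "(s, e, kernel_family r' s e c)"]) (auto simp: x)
  qed
  then obtain f where f: "\<forall>n. ?P n (f n) \<and> ?Q n (f n) (f (Suc n))" by (rule exE)
  define rk where "rk = (\<lambda>n. fst (f n))"
  define dg where "dg = (\<lambda>n. fst (snd (f n)))"
  define W where "W = (\<lambda>n. snd (snd (f n)))"
  have fW: "f n = (rk n, dg n, W n)" for n by (simp add: rk_def dg_def W_def)
  have ex: "\<exists>c. minimal_presentation (rk n) (dg n) (W n) (rk (Suc n)) (dg (Suc n)) c \<and>
      W (Suc n) = kernel_family (rk n) (rk (Suc n)) (dg (Suc n)) c" for n
    using f[rule_format, of n, THEN conjunct2] unfolding fW prod.case .
  from choice[OF allI, OF ex] obtain c where c: "\<forall>n. minimal_presentation (rk n) (dg n) (W n) (rk (Suc n)) (dg (Suc n)) (c n) \<and>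
      W (Suc n) = kernel_family (rk n) (rk (Suc n)) (dg (Suc n)) (c n)"
    by (rule exE)
  have W: "W (Suc n) = kernel_family (rk n) (rk (Suc n)) (dg (Suc n)) (c n)" for n
    by (rule c[rule_format, THEN conjunct2])
  have zero: "rk 0 = r" "dg 0 = d" "W 0 = V" using f[rule_format, of 0, THEN conjunct1] unfolding fW prod.case by blast+
  have "minimal_presentation r d V (rk 1) (dg 1) (c 0)"
    using c[rule_format, of 0, THEN conjunct1] zero by simp
  moreover have "minimal_presentation (rk (Suc n)) (dg (Suc n))
      (kernel_family (rk n) (rk (Suc n)) (dg (Suc n)) (c n)) (rk (Suc (Suc n))) (dg (Suc (Suc n))) (c (Suc n))" for n
    using c[rule_format, of "Suc n", THEN conjunct1] unfolding W .
  ultimately show ?thesis by (rule that[of rk dg c, OF zero(1,2)])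
qed

section \<open>Polynomial matrices and scalar matrices\<close>

lemma lookup_single_mult:
  fixes f :: "('n, 'k::field) mpol"
  shows "Poly_Mapping.lookup (Poly_Mapping.single t c * f) m =
    (if Poly_Mapping.lookup t \<le> Poly_Mapping.lookup m then c * Poly_Mapping.lookup f (m - t) else 0)"
proof -
  have "Poly_Mapping.lookup (Poly_Mapping.single t c * f) m =
      c * (\<Sum>q. Poly_Mapping.lookup f q when m = t + q)"
    by (simp add: lookup_mult lookup_single when_mult)
  also have "(\<Sum>q. Poly_Mapping.lookup f q when m = t + q) =
      (if Poly_Mapping.lookup t \<le> Poly_Mapping.lookup m then Poly_Mapping.lookup f (m - t) else 0)"
  proof (cases "Poly_Mapping.lookup t \<le> Poly_Mapping.lookup m")
    case True
    then have "m = t + q \<longleftrightarrow> m - t = q" for q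
      by (auto simp: poly_mapping_eq_iff fun_eq_iff lookup_add lookup_minus le_fun_def)
        (metis le_add_diff_inverse)
    then show ?thesis using True by simp
  next
    case False
    then have "m \<noteq> t + q" for q by (auto simp: lookup_add le_fun_def)
    then show ?thesis using False by simp
  qed
  finally show ?thesis by simp
qed

interpretation mpol: module "(*) :: ('n, 'k::field) mpol \<Rightarrow> _"
  by standard (simp_all add: algebra_simps)

lemma sum_of_monomials: "f = (\<Sum>m\<in>Poly_Mapping.keys f. Poly_Mapping.single m (Poly_Mapping.lookup f m))"
  by (rule poly_mapping_eqI)
    (auto simp: lookup_sum lookup_single when_def in_keys_iff sum.delta' split: if_splits)

text \<open>A polynomial lies in a monomial ideal iff each of its monomials is divisible by a generator: this
condition defines an ideal, and conversely the polynomial is the sum of its terms.\<close>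

lemma ideal_gen_monomials:
  fixes f :: "('n, 'k::field) mpol"
  shows "f \<in> ideal_gen (mono_poly ` A) \<longleftrightarrow>
    (\<forall>m\<in>Poly_Mapping.keys f. \<exists>g\<in>A. Poly_Mapping.lookup g \<le> Poly_Mapping.lookup m)"
proof
  let ?I = "{f :: ('n, 'k) mpol. \<forall>m\<in>Poly_Mapping.keys f. \<exists>g\<in>A. Poly_Mapping.lookup g \<le> Poly_Mapping.lookup m}"
  have "mpol.subspace ?I"
    unfolding mpol.subspace_def
  proof (intro conjI ballI allI)
    show "0 \<in> ?I" by simp
    fix u v assume "u \<in> ?I" "v \<in> ?I"
    then show "u + v \<in> ?I" using keys_add[of u v] by blast
  next
    fix h u assume u: "u \<in> ?I"
    show "h * u \<in> ?I"
    proof (intro CollectI ballI)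
      fix m assume "m \<in> Poly_Mapping.keys (h * u)"
      then obtain a b where ab: "m = a + b" "b \<in> Poly_Mapping.keys u"
        using keys_mult[of h u] by blast
      then obtain g where "g \<in> A" "Poly_Mapping.lookup g \<le> Poly_Mapping.lookup b" using u by blast
      moreover have "Poly_Mapping.lookup b \<le> Poly_Mapping.lookup m"
        by (simp add: ab(1) lookup_add le_fun_def)
      ultimately show "\<exists>g\<in>A. Poly_Mapping.lookup g \<le> Poly_Mapping.lookup m" by (blast intro: order_trans)
    qed
  qed
  moreover have "mono_poly ` A \<subseteq> ?I" by (auto simp: mono_poly_def)
  ultimately have "ideal_gen (mono_poly ` A) \<subseteq> ?I"
    unfolding ideal_gen_def by (rule mpol.span_minimal[rotated])
  then show "f \<in> ideal_gen (mono_poly ` A) \<Longrightarrow>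
    \<forall>m\<in>Poly_Mapping.keys f. \<exists>g\<in>A. Poly_Mapping.lookup g \<le> Poly_Mapping.lookup m" by blast
next
  assume R: "\<forall>m\<in>Poly_Mapping.keys f. \<exists>g\<in>A. Poly_Mapping.lookup g \<le> Poly_Mapping.lookup m"
  have "Poly_Mapping.single m (Poly_Mapping.lookup f m) \<in> mpol.span (mono_poly ` A)"
    if m: "m \<in> Poly_Mapping.keys f" for m
  proof -
    obtain g where g: "g \<in> A" "Poly_Mapping.lookup g \<le> Poly_Mapping.lookup m" using R m by blast
    have "m - g + g = m"
      using g(2) by (auto simp: poly_mapping_eq_iff fun_eq_iff lookup_add lookup_minus le_fun_def)
    then have "Poly_Mapping.single m (Poly_Mapping.lookup f m) =
        Poly_Mapping.single (m - g) (Poly_Mapping.lookup f m) * mono_poly g"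
      by (simp add: mono_poly_def mult_single)
    then show ?thesis using g(1) by (simp add: mpol.span_scale mpol.span_base)
  qed
  then show "f \<in> ideal_gen (mono_poly ` A)"
    unfolding ideal_gen_def by (subst sum_of_monomials) (rule mpol.span_sum)
qed

lemma irrelevant_ideal_iff:
  fixes f :: "('n, 'k::field) mpol"
  shows "f \<in> irrelevant_ideal \<longleftrightarrow> 0 \<notin> Poly_Mapping.keys f"
proof -
  have "(\<exists>g\<in>range (\<lambda>x. Poly_Mapping.single x (1::nat)). Poly_Mapping.lookup g \<le> Poly_Mapping.lookup m) \<longleftrightarrow> m \<noteq> 0"
    for m :: "'n expo"
  proof -
    have "Poly_Mapping.lookup (Poly_Mapping.single x (1::nat)) \<le> Poly_Mapping.lookup m \<longleftrightarrow>
        Poly_Mapping.lookup m x \<noteq> 0" for x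
      by (auto simp: le_fun_def lookup_single when_def)
    then show ?thesis by (auto simp: poly_mapping_eq_iff fun_eq_iff)
  qed
  then have "f \<in> ideal_gen (mono_poly ` range (\<lambda>x. Poly_Mapping.single x 1)) \<longleftrightarrow> 0 \<notin> Poly_Mapping.keys f"
    unfolding ideal_gen_monomials by auto
  then show ?thesis by (simp add: irrelevant_ideal_def image_image)
qed

text \<open>The degree \<open>a\<close> component of an element of a multigraded free module, as a member of the degree part
that records only scalars.\<close>

definition component ::
  "nat \<Rightarrow> (nat \<Rightarrow> 'n expo) \<Rightarrow> 'n expo \<Rightarrow> (nat \<Rightarrow> ('n, 'k::field) mpol) \<Rightarrow> nat \<Rightarrow> 'k" where
  "component r d a u = (\<lambda>j. if j < r \<and> Poly_Mapping.lookup (d j) \<le> Poly_Mapping.lookup a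
     then Poly_Mapping.lookup (u j) (a - d j) else 0)"

abbreviation expo_part :: "nat \<Rightarrow> (nat \<Rightarrow> 'n expo) \<Rightarrow> 'n expo \<Rightarrow> (nat \<Rightarrow> 'k::field) set" where
  "expo_part r d a \<equiv> degree_part r (\<lambda>j. Poly_Mapping.lookup (d j)) (Poly_Mapping.lookup a)"

definition homogeneous_matrix ::
  "nat \<Rightarrow> nat \<Rightarrow> (nat \<Rightarrow> 'n expo) \<Rightarrow> (nat \<Rightarrow> 'n expo) \<Rightarrow> (nat \<Rightarrow> nat \<Rightarrow> ('n, 'k::field) mpol)
    \<Rightarrow> (nat \<Rightarrow> nat \<Rightarrow> 'k) \<Rightarrow> bool" where
  "homogeneous_matrix r s d d' A c \<longleftrightarrow>
     (\<forall>p<r. \<forall>q<s. A p q = Poly_Mapping.single (d' q - d p) (c p q)) \<and>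
     graded_matrix r s (\<lambda>j. Poly_Mapping.lookup (d j)) (\<lambda>j. Poly_Mapping.lookup (d' j)) c"

lemma component_part: "component r d a u \<in> expo_part r d a"
  by (auto simp: component_def degree_part_def)

lemma component_zero: "component r d a (\<lambda>_. 0) = 0"
  by (auto simp: component_def fun_eq_iff)

text \<open>A homogeneous polynomial matrix acts in each degree by the matrix of its coefficients.\<close>

lemma component_mat_map:
  assumes A: "homogeneous_matrix r s d d' A c"
  shows "component r d a (mat_map r s A u) = mat_vec r s c (component s d' a u)"
proof
  fix p
  show "component r d a (mat_map r s A u) p = mat_vec r s c (component s d' a u) p"
  proof (cases "p < r")
    case False
    then show ?thesis by (simp add: component_def mat_vec_def)
  next
    case p: True
    have le: "Poly_Mapping.lookup (d p) \<le> Poly_Mapping.lookup (d' q)" if "q < s" "c p q \<noteq> 0" for q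
      using A p that by (auto simp: homogeneous_matrix_def graded_matrix_def)
    show ?thesis
    proof (cases "Poly_Mapping.lookup (d p) \<le> Poly_Mapping.lookup a")
      case True
      have "Poly_Mapping.lookup (A p q * u q) (a - d p) = c p q * component s d' a u q" if q: "q < s" for q
      proof (cases "c p q = 0")
        case True
        then show ?thesis using A p q by (simp add: homogeneous_matrix_def)
      next
        case False
        have "A p q = Poly_Mapping.single (d' q - d p) (c p q)"
          using A p q by (simp add: homogeneous_matrix_def)
        moreover have "Poly_Mapping.lookup (d' q - d p) \<le> Poly_Mapping.lookup (a - d p) \<longleftrightarrow>
            Poly_Mapping.lookup (d' q) \<le> Poly_Mapping.lookup a"
          using le[OF q False] True by (auto simp: le_fun_def lookup_minus diff_le_mono) (metis le_diff_iff)
        moreover have "a - d p - (d' q - d p) = a - d' q"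
          using le[OF q False] True by (auto simp: poly_mapping_eq_iff fun_eq_iff lookup_minus le_fun_def)
        ultimately show ?thesis using q by (simp add: lookup_single_mult component_def)
      qed
      then have "(\<Sum>q<s. Poly_Mapping.lookup (A p q * u q) (a - d p)) = (\<Sum>q<s. c p q * component s d' a u q)"
        by (intro sum.cong) auto
      then show ?thesis using p True by (simp add: component_def[of r] mat_map_def mat_vec_def lookup_sum)
    next
      case False
      have "c p q * component s d' a u q = 0" if q: "q < s" for q
        using le[OF q] False by (auto simp: component_def intro: order_trans)
      then have "(\<Sum>q<s. c p q * component s d' a u q) = 0" by (intro sum.neutral) auto
      then show ?thesis using p False by (simp add: component_def[of r] mat_vec_def)
    qed
  qed
qed

lemma component_inject:
  assumes "u \<in> free_mod r" "v \<in> free_mod r" "\<And>a. component r d a u = component r d a v"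
  shows "u = v"
proof
  fix j
  show "u j = v j"
  proof (cases "j < r")
    case True
    have "Poly_Mapping.lookup (u j) m = Poly_Mapping.lookup (v j) m" for m
    proof -
      have "component r d (m + d j) u j = component r d (m + d j) v j" using assms(3) by simp
      then show ?thesis using True by (simp add: component_def lookup_add le_fun_def)
    qed
    then show ?thesis by (rule poly_mapping_eqI)
  next
    case False
    then show ?thesis using assms(1,2) by (simp add: free_mod_def)
  qed
qed

text \<open>Together with \<open>component_inject\<close> and \<open>finite_components\<close> this says that a free module is the
direct sum of its degree parts.\<close>

lemma component_exists:
  fixes w :: "'n expo \<Rightarrow> nat \<Rightarrow> 'k::field"
  assumes w: "\<And>a. w a \<in> expo_part r d a" and fin: "finite {a. w a \<noteq> 0}"
  obtains u :: "nat \<Rightarrow> ('n, 'k) mpol" where "u \<in> free_mod r" "\<And>a. component r d a u = w a"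
proof
  let ?S = "{a. w a \<noteq> 0}"
  let ?u = "\<lambda>j. if j < r then \<Sum>a\<in>?S. Poly_Mapping.single (a - d j) (w a j) else 0"
  show "?u \<in> free_mod r" by (simp add: free_mod_def)
  fix b
  show "component r d b ?u = w b"
  proof
    fix j
    show "component r d b ?u j = w b j"
    proof (cases "j < r \<and> Poly_Mapping.lookup (d j) \<le> Poly_Mapping.lookup b")
      case False
      then show ?thesis using w[of b] by (auto simp: component_def degree_part_def)
    next
      case True
      have "(w a j when a - d j = b - d j) = (w b j when a = b)" for a
      proof (cases "w a j = 0")
        case False
        then have "Poly_Mapping.lookup (d j) \<le> Poly_Mapping.lookup a"
          using w[of a] by (auto simp: degree_part_def)
        then have "a - d j = b - d j \<longleftrightarrow> a = b"
          using True by (auto simp: poly_mapping_eq_iff fun_eq_iff lookup_minus le_fun_def) (metis eq_diff_iff)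
        then show ?thesis by (auto simp: when_def)
      qed (auto simp: when_def)
      then have "(\<Sum>a\<in>?S. w a j when a - d j = b - d j) = (\<Sum>a\<in>?S. if a = b then w b j else 0)"
        by (simp add: when_def)
      also have "\<dots> = w b j" using fin by (auto simp: sum.delta)
      finally show ?thesis using True by (simp add: component_def lookup_sum lookup_single)
    qed
  qed
qed

lemma finite_components: "finite {a. component r d a u \<noteq> 0}"
proof (rule finite_subset)
  show "{a. component r d a u \<noteq> 0} \<subseteq> (\<Union>j<r. (\<lambda>m. m + d j) ` Poly_Mapping.keys (u j))"
  proof
    fix a assume "a \<in> {a. component r d a u \<noteq> 0}"
    then obtain j where j: "component r d a u j \<noteq> 0" by (auto simp: fun_eq_iff)
    then have "j < r" "Poly_Mapping.lookup (d j) \<le> Poly_Mapping.lookup a" "a - d j \<in> Poly_Mapping.keys (u j)"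
      by (auto simp: component_def in_keys_iff split: if_splits)
    moreover from this have "a = (a - d j) + d j"
      by (auto simp: poly_mapping_eq_iff fun_eq_iff lookup_add lookup_minus le_fun_def)
    ultimately show "a \<in> (\<Union>j<r. (\<lambda>m. m + d j) ` Poly_Mapping.keys (u j))" by blast
  qed
qed auto

lemma single_component_exists:
  assumes "v \<in> expo_part r d a"
  obtains u :: "nat \<Rightarrow> ('n, 'k::field) mpol" where "u \<in> free_mod r" "component r d a u = v"
    "\<And>b. b \<noteq> a \<Longrightarrow> component r d b u = 0"
proof -
  have "(if b = a then v else 0) \<in> expo_part r d b" for b
    using assms by (simp add: degree_part_zero)
  moreover have "finite {b. (if b = a then v else 0) \<noteq> 0}"
    by (rule finite_subset[of _ "{a}"]) auto
  ultimately obtain u :: "nat \<Rightarrow> ('n, 'k) mpol"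
    where "u \<in> free_mod r" "\<And>b. component r d b u = (if b = a then v else 0)"
    by (rule component_exists[where w = "\<lambda>b. if b = a then v else 0"]) blast
  then show ?thesis using that by simp
qed

text \<open>A multigraded submodule is the image of a homogeneous map iff this holds in every degree.  In the
nontrivial direction preimages of the finitely many nonzero components are glued; the preimage of
a zero component is taken to be zero, which keeps their number finite.\<close>

lemma mat_map_image_iff:
  fixes A :: "nat \<Rightarrow> nat \<Rightarrow> ('n, 'k::field) mpol"
  assumes A: "homogeneous_matrix r s d d' A c"
    and V: "\<And>a. V a \<subseteq> expo_part r d a" "\<And>a. 0 \<in> V a"
  shows "{u \<in> free_mod r. \<forall>a. component r d a u \<in> V a} = mat_map r s A ` free_mod s \<longleftrightarrow>
    (\<forall>a. V a = mat_vec r s c ` expo_part s d' a)" (is "?K = ?I \<longleftrightarrow> _")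
proof
  assume eq: "?K = ?I"
  show "\<forall>a. V a = mat_vec r s c ` expo_part s d' a"
  proof (intro allI equalityI subsetI)
    fix a v assume v: "v \<in> V a"
    then have "v \<in> expo_part r d a" using V(1) by blast
    then obtain u :: "nat \<Rightarrow> ('n, 'k) mpol" where u: "u \<in> free_mod r" "component r d a u = v"
      "\<And>b. b \<noteq> a \<Longrightarrow> component r d b u = 0"
      by (rule single_component_exists) blast
    have "component r d b u \<in> V b" for b using u v V(2) by (cases "b = a") auto
    then have "u \<in> ?I" using u(1) eq by blast
    then obtain t where "u = mat_map r s A t" by blast
    then have "v = mat_vec r s c (component s d' a t)" using u(2) component_mat_map[OF A] by metis
    then show "v \<in> mat_vec r s c ` expo_part s d' a" using component_part by blast
  next
    fix a v assume "v \<in> mat_vec r s c ` expo_part s d' a"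
    then obtain w where w: "w \<in> expo_part s d' a" "v = mat_vec r s c w" by blast
    obtain t :: "nat \<Rightarrow> ('n, 'k) mpol" where t: "t \<in> free_mod s" "component s d' a t = w"
      using single_component_exists[OF w(1)] by metis
    have "mat_map r s A t \<in> ?K" using t(1) eq by blast
    then have "component r d a (mat_map r s A t) \<in> V a" by blast
    then show "v \<in> V a" using component_mat_map[OF A, of a t] t(2) w(2) by simp
  qed
next
  assume eq: "\<forall>a. V a = mat_vec r s c ` expo_part s d' a"
  show "?K = ?I"
  proof (intro equalityI subsetI)
    fix u assume u: "u \<in> ?K"
    have "\<exists>w. w \<in> expo_part s d' a \<and> mat_vec r s c w = component r d a u \<and> (component r d a u = 0 \<longrightarrow> w = 0)" for a
    proof (cases "component r d a u = 0")
      case True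
      then show ?thesis by (intro exI[of _ 0]) (simp add: degree_part_zero)
    next
      case False
      moreover have "component r d a u \<in> mat_vec r s c ` expo_part s d' a" using u eq by blast
      ultimately show ?thesis by (metis imageE)
    qed
    from choice[OF allI, OF this] obtain w where w:
      "\<forall>a. w a \<in> expo_part s d' a \<and> mat_vec r s c (w a) = component r d a u \<and> (component r d a u = 0 \<longrightarrow> w a = 0)"
      by (rule exE)
    have "finite {a. w a \<noteq> 0}"
      by (rule finite_subset[OF _ finite_components[of r d u]]) (use w in auto)
    then obtain t :: "nat \<Rightarrow> ('n, 'k) mpol" where t: "t \<in> free_mod s" "\<And>a. component s d' a t = w a"
      by (rule component_exists[rotated]) (use w in blast)+
    have "mat_map r s A t = u"
    proof (rule component_inject[where d = d])
      show "mat_map r s A t \<in> free_mod r" by (simp add: free_mod_def mat_map_def)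
      show "u \<in> free_mod r" using u by blast
      show "component r d a (mat_map r s A t) = component r d a u" for a
        using component_mat_map[OF A, of a t] t(2)[of a] w by simp
    qed
    then show "u \<in> ?I" using t(1) by blast
  next
    fix u assume "u \<in> ?I"
    then obtain t where t: "u = mat_map r s A t" by blast
    have "component r d a u \<in> V a" for a
      unfolding t component_mat_map[OF A] using eq component_part by blast
    moreover have "u \<in> free_mod r" by (simp add: t free_mod_def mat_map_def)
    ultimately show "u \<in> ?K" by blast
  qed
qed

lemma mat_map_kernel:
  assumes A: "homogeneous_matrix r s d d' A c"
  shows "mat_map r s A u = (\<lambda>_. 0) \<longleftrightarrow> (\<forall>a. mat_vec r s c (component s d' a u) = 0)"
proof
  assume "mat_map r s A u = (\<lambda>_. 0)"
  then show "\<forall>a. mat_vec r s c (component s d' a u) = 0"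
    using component_mat_map[OF A, of _ u] component_zero[of r d] by metis
next
  assume "\<forall>a. mat_vec r s c (component s d' a u) = 0"
  then have "component r d a (mat_map r s A u) = component r d a (\<lambda>_. 0)" for a
    by (simp add: component_mat_map[OF A] component_zero)
  moreover have "mat_map r s A u \<in> free_mod r" "(\<lambda>_. 0) \<in> free_mod r"
    by (simp_all add: free_mod_def mat_map_def)
  ultimately show "mat_map r s A u = (\<lambda>_. 0)" by (intro component_inject)
qed

lemma lookup_augment:
  assumes "\<And>j. j < r \<Longrightarrow> e j = Poly_Mapping.single (d j) (aug j)"
  shows "Poly_Mapping.lookup (augment r e u) a = (\<Sum>j<r. aug j * component r d a u j)"
proof -
  have "Poly_Mapping.lookup (augment r e u) a = (\<Sum>j<r. Poly_Mapping.lookup (e j * u j) a)"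
    by (simp add: augment_def lookup_sum)
  also have "\<dots> = (\<Sum>j<r. aug j * component r d a u j)"
    by (intro sum.cong) (auto simp: assms lookup_single_mult component_def)
  finally show ?thesis .
qed

section \<open>Minimal free resolutions degree by degree\<close>

lemma all_expo_iff:
  "(\<forall>a :: 'n::finite expo. P (Poly_Mapping.lookup a)) \<longleftrightarrow> (\<forall>a. P a)"
proof
  assume R: "\<forall>a :: 'n expo. P (Poly_Mapping.lookup a)"
  show "\<forall>a. P a"
  proof
    fix a :: "'n \<Rightarrow> nat"
    have "P (Poly_Mapping.lookup (Abs_poly_mapping a))" using R by blast
    then show "P a" by simp
  qed
qed blast

text \<open>Exactness at \<open>F\<^sub>0\<close>, and in \<open>exact_kernel_iff\<close> at the later modules, is the equality of a multigraded
submodule with the image of a homogeneous map and can be tested in each degree.\<close>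

lemma exact_augment_iff:
  fixes M :: "('n::finite, 'k::field) mpol set"
  assumes M: "\<And>f. f \<in> M \<longleftrightarrow> (\<forall>m\<in>Poly_Mapping.keys f. Poly_Mapping.lookup m \<in> N)"
    and hom: "homogeneous_matrix r s d d' A c"
    and e: "\<And>j. j < r \<Longrightarrow> e j = Poly_Mapping.single (d j) (aug j)"
  shows "{u \<in> free_mod r. augment r e u \<in> M} = mat_map r s A ` free_mod s \<longleftrightarrow>
    (\<forall>a. {w \<in> degree_part r (\<lambda>j. Poly_Mapping.lookup (d j)) a. a \<in> N \<or> (\<Sum>j<r. aug j * w j) = 0}
      = mat_vec r s c ` degree_part s (\<lambda>j. Poly_Mapping.lookup (d' j)) a)"
proof -
  let ?V = "\<lambda>a. {w \<in> expo_part r d a. Poly_Mapping.lookup a \<in> N \<or> (\<Sum>j<r. aug j * w j) = 0}"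
  have "m \<in> Poly_Mapping.keys (augment r e u) \<longleftrightarrow> (\<Sum>j<r. aug j * component r d m u j) \<noteq> 0" for m u
    unfolding in_keys_iff by (subst lookup_augment[OF e]) simp_all
  then have "augment r e u \<in> M \<longleftrightarrow> (\<forall>a. component r d a u \<in> ?V a)" for u
    unfolding M using component_part[of r d _ u] by auto
  then have "{u \<in> free_mod r. augment r e u \<in> M} = {u \<in> free_mod r. \<forall>a. component r d a u \<in> ?V a}"
    by simp
  moreover have "{u \<in> free_mod r. \<forall>a. component r d a u \<in> ?V a} = mat_map r s A ` free_mod s \<longleftrightarrow>
      (\<forall>a. ?V a = mat_vec r s c ` expo_part s d' a)"
    by (rule mat_map_image_iff[OF hom]) (auto simp: degree_part_zero)
  ultimately show ?thesis
    using all_expo_iff[of "\<lambda>a. {w \<in> degree_part r (\<lambda>j. Poly_Mapping.lookup (d j)) a.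
        a \<in> N \<or> (\<Sum>j<r. aug j * w j) = 0} = mat_vec r s c ` degree_part s (\<lambda>j. Poly_Mapping.lookup (d' j)) a"]
    by simp
qed

lemma exact_kernel_iff:
  fixes A :: "nat \<Rightarrow> nat \<Rightarrow> ('n::finite, 'k::field) mpol"
  assumes A: "homogeneous_matrix r s d d' A c" and A': "homogeneous_matrix s t d' d'' A' c'"
  shows "{u \<in> free_mod s. mat_map r s A u = (\<lambda>_. 0)} = mat_map s t A' ` free_mod t \<longleftrightarrow>
    (\<forall>a. {w \<in> degree_part s (\<lambda>j. Poly_Mapping.lookup (d' j)) a. mat_vec r s c w = 0}
      = mat_vec s t c' ` degree_part t (\<lambda>j. Poly_Mapping.lookup (d'' j)) a)"
proof -
  let ?V = "\<lambda>a. {w \<in> expo_part s d' a. mat_vec r s c w = 0}"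
  have "mat_map r s A u = (\<lambda>_. 0) \<longleftrightarrow> (\<forall>a. component s d' a u \<in> ?V a)" for u
    unfolding mat_map_kernel[OF A] using component_part[of s d' _ u] by auto
  then have "{u \<in> free_mod s. mat_map r s A u = (\<lambda>_. 0)} = {u \<in> free_mod s. \<forall>a. component s d' a u \<in> ?V a}"
    by simp
  moreover have "{u \<in> free_mod s. \<forall>a. component s d' a u \<in> ?V a} = mat_map s t A' ` free_mod t \<longleftrightarrow>
      (\<forall>a. ?V a = mat_vec s t c' ` expo_part t d'' a)"
    by (rule mat_map_image_iff[OF A']) (auto simp: degree_part_zero)
  ultimately show ?thesis
    using all_expo_iff[of "\<lambda>a. {w \<in> degree_part s (\<lambda>j. Poly_Mapping.lookup (d' j)) a. mat_vec r s c w = 0}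
      = mat_vec s t c' ` degree_part t (\<lambda>j. Poly_Mapping.lookup (d'' j)) a"]
    by simp
qed

text \<open>Homogeneity forces every entry of a differential to be a scalar multiple of a single monomial, so
nothing is lost by passing to the scalars.\<close>

lemma minimal_resolution_degreewise:
  fixes M :: "('n::finite, 'k::field) mpol set"
  assumes M: "\<And>f. f \<in> M \<longleftrightarrow> (\<forall>m\<in>Poly_Mapping.keys f. Poly_Mapping.lookup m \<in> N)"
    and res: "minimal_free_resolution M rk dg e D"
  shows "degreewise_resolution rk (\<lambda>i j. Poly_Mapping.lookup (dg i j))
    (\<lambda>i p q. Poly_Mapping.lookup (D i p q) (dg (Suc i) q - dg i p))
    (\<lambda>j. Poly_Mapping.lookup (e j) (dg 0 j)) N"
proof -
  let ?d = "\<lambda>i j. Poly_Mapping.lookup (dg i j)"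
  let ?c = "\<lambda>i p q. Poly_Mapping.lookup (D i p q) (dg (Suc i) q - dg i p)"
  let ?aug = "\<lambda>j. Poly_Mapping.lookup (e j) (dg 0 j)"
  have fr: "free_resolution M rk e D" and mg: "multigraded rk dg e D"
    and min: "\<And>i p q. p < rk i \<Longrightarrow> q < rk (Suc i) \<Longrightarrow> D i p q \<in> irrelevant_ideal"
    using res by (auto simp: minimal_free_resolution_def)
  have key: "m + dg i p = dg (Suc i) q" if "p < rk i" "q < rk (Suc i)" "m \<in> Poly_Mapping.keys (D i p q)" for i p q m
    using mg that by (auto simp: multigraded_def)
  have e: "e j = Poly_Mapping.single (dg 0 j) (?aug j)" if "j < rk 0" for j
  proof (rule poly_mapping_eqI)
    fix k
    have "k \<notin> Poly_Mapping.keys (e j)" if "k \<noteq> dg 0 j"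
      using mg \<open>j < rk 0\<close> that unfolding multigraded_def by blast
    then show "Poly_Mapping.lookup (e j) k = Poly_Mapping.lookup (Poly_Mapping.single (dg 0 j) (?aug j)) k"
      by (cases "k = dg 0 j") (simp_all add: lookup_single not_in_keys_iff_lookup_eq_zero)
  qed
  have hom: "homogeneous_matrix (rk i) (rk (Suc i)) (dg i) (dg (Suc i)) (D i) (?c i)" for i
    unfolding homogeneous_matrix_def graded_matrix_def
  proof (intro conjI allI impI)
    fix p q assume pq: "p < rk i" "q < rk (Suc i)"
    show "D i p q = Poly_Mapping.single (dg (Suc i) q - dg i p) (?c i p q)"
    proof (rule poly_mapping_eqI)
      fix m
      have "dg (Suc i) q - dg i p = m" if "Poly_Mapping.lookup (D i p q) m \<noteq> 0"
        using key[OF pq, of m] that by (auto simp: in_keys_iff) (metis add_diff_cancel_right')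
      then show "Poly_Mapping.lookup (D i p q) m
          = Poly_Mapping.lookup (Poly_Mapping.single (dg (Suc i) q - dg i p) (?c i p q)) m"
        by (auto simp: lookup_single when_def)
    qed
    assume "?c i p q \<noteq> 0"
    then have "dg (Suc i) q - dg i p + dg i p = dg (Suc i) q"
      using key[OF pq] by (auto simp: in_keys_iff)
    then show "?d i p \<le> ?d (Suc i) q" by (metis le_add2 le_funI lookup_add)
  qed
  show ?thesis
  proof
    fix i
    show "graded_matrix (rk i) (rk (Suc i)) (?d i) (?d (Suc i)) (?c i)"
      using hom by (simp add: homogeneous_matrix_def)
  next
    fix p i q assume pq: "p < rk i" "q < rk (Suc i)" "?c i p q \<noteq> 0"
    show "?d i p \<noteq> ?d (Suc i) q"
    proof
      assume "?d i p = ?d (Suc i) q"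
      then have "dg (Suc i) q - dg i p = 0" by (simp add: poly_mapping_eq_iff fun_eq_iff lookup_minus)
      then show False using min[OF pq(1,2)] pq(3) by (simp add: irrelevant_ideal_iff in_keys_iff)
    qed
  next
    fix a assume a: "a \<notin> N"
    let ?a = "Abs_poly_mapping a"
    have "\<exists>u\<in>free_mod (rk 0). Poly_Mapping.single ?a 1 - augment (rk 0) e u \<in> M"
      using fr unfolding free_resolution_def by blast
    then obtain u where "Poly_Mapping.single ?a 1 - augment (rk 0) e u \<in> M" by blast
    then have "?a \<notin> Poly_Mapping.keys (Poly_Mapping.single ?a 1 - augment (rk 0) e u)"
      using a unfolding M by force
    then have "Poly_Mapping.lookup (Poly_Mapping.single ?a 1 - augment (rk 0) e u) ?a = 0"
      by (simp add: not_in_keys_iff_lookup_eq_zero)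
    then have "(\<Sum>j<rk 0. ?aug j * component (rk 0) (dg 0) ?a u j) = 1"
      using lookup_augment[of "rk 0" e "dg 0" ?aug u ?a, OF e] by (simp add: lookup_minus)
    moreover have "component (rk 0) (dg 0) ?a u \<in> degree_part (rk 0) (?d 0) a"
      using component_part[of "rk 0" "dg 0" ?a u] by simp
    ultimately show "\<exists>w\<in>degree_part (rk 0) (?d 0) a. (\<Sum>j<rk 0. ?aug j * w j) = 1" by blast
  next
    fix a
    show "{w \<in> degree_part (rk 0) (?d 0) a. a \<in> N \<or> (\<Sum>j<rk 0. ?aug j * w j) = 0}
          = mat_vec (rk 0) (rk 1) (?c 0) ` degree_part (rk 1) (?d 1) a"
      using fr[unfolded free_resolution_def, THEN conjunct2, THEN conjunct1]
        exact_augment_iff[where aug = ?aug, OF M hom[of 0] e] by simp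
  next
    fix i a
    have "{u \<in> free_mod (rk (Suc i)). mat_map (rk i) (rk (Suc i)) (D i) u = (\<lambda>_. 0)}
       = mat_map (rk (Suc i)) (rk (Suc (Suc i))) (D (Suc i)) ` free_mod (rk (Suc (Suc i)))"
      using fr unfolding free_resolution_def by simp
    then show "{w \<in> degree_part (rk (Suc i)) (?d (Suc i)) a. mat_vec (rk i) (rk (Suc i)) (?c i) w = 0}
          = mat_vec (rk (Suc i)) (rk (Suc (Suc i))) (?c (Suc i))
              ` degree_part (rk (Suc (Suc i))) (?d (Suc (Suc i))) a"
      unfolding exact_kernel_iff[OF hom[of i] hom[of "Suc i"]] by blast
  qed
qed

text \<open>The construction starts from \<open>F\<^sub>0 = S\<close> and the submodule \<open>M\<close> of \<open>S\<close>.  If \<open>M = S\<close>, then \<open>M\<close> is not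
contained in \<open>(x\<^sub>1, \<dots>, x\<^sub>n) S\<close>, and \<open>F\<^sub>0 = 0\<close> is the minimal choice.\<close>

lemma minimal_resolution_exists:
  fixes M :: "('n::finite, 'k::field) mpol set"
  assumes M: "\<And>f. f \<in> M \<longleftrightarrow> (\<forall>m\<in>Poly_Mapping.keys f. Poly_Mapping.lookup m \<in> N)"
    and up: "\<And>a b. a \<in> N \<Longrightarrow> a \<le> b \<Longrightarrow> b \<in> N"
  obtains rk dg e D where "minimal_free_resolution M rk dg e D"
proof -
  define r :: nat where "r = (if (\<lambda>_. 0) \<in> N then 0 else 1)"
  define d where "d = (\<lambda>(_::nat) (_::'n). 0::nat)"
  define V where "V = (\<lambda>a. {w :: nat \<Rightarrow> 'k. w \<in> degree_part r d a \<and> (a \<in> N \<or> (\<Sum>j<r. 1 * w j) = 0)})"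
  have "syzygy_family r d V"
    unfolding syzygy_family_def
  proof (intro conjI allI impI ballI)
    fix a b :: "'n \<Rightarrow> nat"
    show "vec.subspace (V a)"
      by (auto simp: V_def vec.subspace_def degree_part_zero degree_part_add degree_part_scal scal_apply
          sum.distrib sum_distrib_left[symmetric])
    show "V a \<subseteq> degree_part r d a" by (auto simp: V_def)
    show "V a \<subseteq> V b" if "a \<le> b" using up[OF _ that] degree_part_mono[OF that] by (auto simp: V_def)
    fix w j assume w: "w \<in> V a" "w j \<noteq> 0"
    then have "j < r" by (auto simp: V_def degree_part_def)
    then have r: "r = 1" "j = 0" "(\<lambda>_. 0) \<notin> N" by (auto simp: r_def split: if_splits)
    show "d j \<noteq> a"
    proof
      assume "d j = a"
      then have "a \<notin> N" using r(3) by (auto simp: d_def)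
      then show False using w r by (simp add: V_def)
    qed
  qed
  then obtain rk dg c where rk0: "rk 0 = r" and dg0: "dg 0 = d"
    and pres0: "minimal_presentation r d V (rk 1) (dg 1) (c 0)"
    and pres: "\<And>i. minimal_presentation (rk (Suc i)) (dg (Suc i))
      (kernel_family (rk i) (rk (Suc i)) (dg (Suc i)) (c i)) (rk (Suc (Suc i))) (dg (Suc (Suc i))) (c (Suc i))"
    by (rule iterated_presentation) blast
  define E where "E = (\<lambda>i j. Abs_poly_mapping (dg i j))"
  have lookup_E [simp]: "Poly_Mapping.lookup (E i j) = dg i j" for i j by (simp add: E_def)
  define D where "D = (\<lambda>i p q. Poly_Mapping.single (E (Suc i) q - E i p) (c i p q))"
  define e where "e = (\<lambda>(j::nat). 1 :: ('n, 'k) mpol)"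
  have gr: "graded_matrix (rk i) (rk (Suc i)) (dg i) (dg (Suc i)) (c i)" for i
    using pres0 pres[of "i - 1"] rk0 dg0 by (cases i) (auto simp: minimal_presentation_def)
  have ne: "dg i p \<noteq> dg (Suc i) q" if "p < rk i" "q < rk (Suc i)" "c i p q \<noteq> 0" for i p q
    using pres0 pres[of "i - 1"] rk0 dg0 that by (cases i) (auto simp: minimal_presentation_def)
  have le: "dg i p \<le> dg (Suc i) q" if "p < rk i" "q < rk (Suc i)" "c i p q \<noteq> 0" for i p q
    using gr[of i] that by (auto simp: graded_matrix_def)
  have hom: "homogeneous_matrix (rk i) (rk (Suc i)) (E i) (E (Suc i)) (D i) (c i)" for i
    using gr[of i] by (simp add: homogeneous_matrix_def D_def)
  have "E 0 j = 0" for j by (simp add: E_def dg0 d_def)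
  then have e: "e j = Poly_Mapping.single (E 0 j) 1" for j by (simp add: e_def)
  have "free_resolution M rk e D"
    unfolding free_resolution_def
  proof (intro conjI allI)
    fix f :: "('n, 'k) mpol"
    show "\<exists>u\<in>free_mod (rk 0). f - augment (rk 0) e u \<in> M"
    proof (cases "(\<lambda>_. 0) \<in> N")
      case True
      then have "b \<in> N" for b using up[OF True, of b] by (simp add: le_fun_def)
      then show ?thesis by (intro bexI[of _ "\<lambda>_. 0"]) (auto simp: M free_mod_def)
    next
      case False
      then have "rk 0 = 1" by (simp add: rk0 r_def)
      then show ?thesis
        by (intro bexI[of _ "\<lambda>j. if j = 0 then f else 0"]) (auto simp: M free_mod_def augment_def e_def)
    qed
  next
    have "{w \<in> degree_part (rk 0) (dg 0) a. a \<in> N \<or> (\<Sum>j<rk 0. 1 * w j) = 0}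
        = mat_vec (rk 0) (rk (Suc 0)) (c 0) ` degree_part (rk (Suc 0)) (dg (Suc 0)) a" for a
      using pres0 unfolding minimal_presentation_def V_def rk0 dg0 One_nat_def by blast
    then show "{u \<in> free_mod (rk 0). augment (rk 0) e u \<in> M} = mat_map (rk 0) (rk 1) (D 0) ` free_mod (rk 1)"
      unfolding One_nat_def by (subst exact_augment_iff[OF M hom e]) simp
  next
    fix i
    have "{w \<in> degree_part (rk (Suc i)) (dg (Suc i)) a. mat_vec (rk i) (rk (Suc i)) (c i) w = 0}
        = mat_vec (rk (Suc i)) (rk (Suc (Suc i))) (c (Suc i)) ` degree_part (rk (Suc (Suc i))) (dg (Suc (Suc i))) a" for a
      using pres[of i] unfolding minimal_presentation_def by blast
    then have "{u \<in> free_mod (rk (Suc i)). mat_map (rk i) (rk (Suc i)) (D i) u = (\<lambda>_. 0)}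
       = mat_map (rk (Suc i)) (rk (Suc (Suc i))) (D (Suc i)) ` free_mod (rk (Suc (Suc i)))"
      by (subst exact_kernel_iff[OF hom hom]) simp
    then show "{u \<in> free_mod (rk (i + 1)). mat_map (rk i) (rk (i + 1)) (D i) u = (\<lambda>_. 0)}
       = mat_map (rk (i + 1)) (rk (i + 2)) (D (i + 1)) ` free_mod (rk (i + 2))"
      by simp
  qed
  moreover have "multigraded rk E e D"
    unfolding multigraded_def
  proof (intro conjI allI impI ballI)
    fix j m assume "m \<in> Poly_Mapping.keys (e j)"
    then show "m = E 0 j" unfolding e by simp
  next
    fix i p q m assume pq: "p < rk i" "q < rk (i + 1)" and m: "m \<in> Poly_Mapping.keys (D i p q)"
    then have "c i p q \<noteq> 0" "m = E (Suc i) q - E i p" by (auto simp: D_def split: if_splits)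
    then show "m + E i p = E (i + 1) q"
      using le[of p i q] pq by (simp add: poly_mapping_eq_iff fun_eq_iff lookup_add lookup_minus le_fun_def)
  qed
  moreover have "D i p q \<in> irrelevant_ideal" if pq: "p < rk i" "q < rk (i + 1)" for i p q
  proof -
    have "E (Suc i) q - E i p \<noteq> 0" if c: "c i p q \<noteq> 0"
    proof
      assume "E (Suc i) q - E i p = 0"
      then have "dg (Suc i) q x - dg i p x = 0" for x by (metis lookup_E lookup_minus lookup_zero)
      then have "dg (Suc i) q \<le> dg i p" by (simp add: le_fun_def)
      then show False using le[of p i q] ne[of p i q] pq c by simp
    qed
    then show ?thesis by (auto simp: irrelevant_ideal_iff D_def in_keys_iff lookup_single when_def)
  qed
  ultimately have "minimal_free_resolution M rk E e D" by (simp add: minimal_free_resolution_def)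
  then show ?thesis by (rule that)
qed

section \<open>Projective dimension and the socle\<close>

text \<open>The Betti numbers beyond \<open>n\<close> vanish, so the projective dimension is \<open>n\<close> iff the \<open>n\<close>-th one is
nonzero; and that one counts the socle monomials of \<open>S/M\<close>.\<close>

lemma pd_quot_eq_nvars_iff:
  fixes M :: "('n::finite, 'k::field) mpol set"
  assumes M: "\<And>f. f \<in> M \<longleftrightarrow> (\<forall>m\<in>Poly_Mapping.keys f. Poly_Mapping.lookup m \<in> N)"
    and up: "\<And>a b. a \<in> N \<Longrightarrow> a \<le> b \<Longrightarrow> b \<in> N"
  shows "pd_quot M = ereal (real CARD('n)) \<longleftrightarrow> (\<exists>a. socle_at N UNIV a)"
proof -
  let ?n = "CARD('n)" and ?S = "{a. socle_at N UNIV a}"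
  have "\<exists>rk dg e D. minimal_free_resolution M rk dg e D"
    by (rule minimal_resolution_exists[of M N, OF M up]) (assumption | rule exI)+
  then obtain rk dg e D where res: "minimal_free_resolution M rk dg e D" by blast
  have betti: "betti_quot M i = r"
    if "\<And>rk' dg' e' D'. minimal_free_resolution M rk' dg' e' D' \<Longrightarrow> rk' i = r" for i r
    unfolding betti_quot_def using res that by (intro the_equality) blast+
  have large: "betti_quot M i = 0" if "?n < i" for i
    using degreewise_resolution.rank_beyond_zero[OF minimal_resolution_degreewise[OF M] that] by (intro betti) blast
  have bij: "bij_betw (\<lambda>j. Poly_Mapping.lookup (dg' ?n j)) {..<rk' ?n} ?S"
    if "minimal_free_resolution M rk' dg' e' D'" for rk' dg' e' D'
    using degreewise_resolution.rank_top[OF minimal_resolution_degreewise[OF M that]] .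
  have "betti_quot M ?n = card ?S"
    using bij_betw_same_card[OF bij] by (intro betti) simp
  moreover have "finite ?S" using bij_betw_finite[OF bij[OF res]] by simp
  ultimately have top: "betti_quot M ?n \<noteq> 0 \<longleftrightarrow> (\<exists>a. socle_at N UNIV a)" by auto
  let ?I = "{i. betti_quot M i \<noteq> 0}"
  have le: "i \<le> ?n" if "i \<in> ?I" for i using large[of i] that by (auto simp: not_less[symmetric])
  show ?thesis
  proof (cases "?n \<in> ?I")
    case True
    then have "pd_quot M = ereal (real ?n)"
      unfolding pd_quot_def using le by (intro antisym SUP_least SUP_upper) auto
    then show ?thesis using top True by simp
  next
    case False
    have "pd_quot M \<le> ereal (real (?n - 1))"
      unfolding pd_quot_def
    proof (rule SUP_least)
      fix i assume "i \<in> ?I"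
      then have "i \<le> ?n" "i \<noteq> ?n" using le False by auto
      then show "ereal (real i) \<le> ereal (real (?n - 1))" by simp
    qed
    also have "\<dots> < ereal (real ?n)" by simp
    finally show ?thesis using top False by simp
  qed
qed

section \<open>Socle monomials and dominant sets\<close>

lemma lookup_lcm_expo_attained:
  assumes "m \<in> L" "\<And>m'. m' \<in> L \<Longrightarrow> Poly_Mapping.lookup m' x \<le> Poly_Mapping.lookup m x"
  shows "Poly_Mapping.lookup (lcm_expo L) x = Poly_Mapping.lookup m x"
  unfolding lookup_lcm_expo using assms by (intro cSup_eq_maximum) auto

text \<open>The exponent \<open>a\<close> corresponds to \<open>lcm L\<close>.  If \<open>x\<^sup>b\<close> is a socle monomial and \<open>a = b + (1, \<dots>, 1)\<close>, then
for every variable \<open>x\<close> some generator divides the product of \<open>x\<close> and \<open>x\<^sup>b\<close> but not \<open>x\<^sup>b\<close>; its exponent is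
\<open>a x\<close> at \<open>x\<close> and at most \<open>b y < a y\<close> at every other variable \<open>y\<close>.  These generators form a dominant
set with lcm \<open>x\<^sup>a\<close>.  Conversely the dominant variables of the \<open>n\<close> elements of \<open>L\<close> are distinct and
exhaust all variables, so each exponent of the lcm is attained by one element only.  On both sides,
a generator strongly divides \<open>x\<^sup>a\<close> iff it divides \<open>x\<^sup>b\<close>, as all entries of \<open>a\<close> are positive.\<close>

lemma socle_iff_dominant:
  fixes G :: "'n::finite expo set"
  defines "N \<equiv> {a. \<exists>g\<in>G. Poly_Mapping.lookup g \<le> a}"
  shows "(\<exists>a. socle_at N UNIV a) \<longleftrightarrow>
    (\<exists>L\<subseteq>G. dominant_set L \<and> card L = CARD('n) \<and> (\<forall>g\<in>G. \<not> strongly_divides g (lcm_expo L)))"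
    (is "?L = ?R")
proof
  assume ?L
  then obtain a where pos: "\<And>x. 0 < a x" and notin: "(\<lambda>x. a x - 1) \<notin> N"
    and "\<And>x. (\<lambda>y. a y - 1)(x := a x) \<in> N"
    by (auto simp: socle_at_def shift_def)
  then have "\<forall>x. \<exists>g\<in>G. Poly_Mapping.lookup g \<le> (\<lambda>y. a y - 1)(x := a x)" by (simp add: N_def)
  then obtain g where g: "\<And>x. g x \<in> G" "\<And>x. Poly_Mapping.lookup (g x) \<le> (\<lambda>y. a y - 1)(x := a x)"
    by metis
  have off: "Poly_Mapping.lookup (g y) x < a x" if "y \<noteq> x" for x y
    using le_funD[OF g(2)[of y], of x] pos[of x] that by simp
  have diag: "Poly_Mapping.lookup (g x) x = a x" for x
  proof (rule ccontr)
    assume "Poly_Mapping.lookup (g x) x \<noteq> a x"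
    then have "Poly_Mapping.lookup (g x) y \<le> a y - 1" for y
      using le_funD[OF g(2)[of x], of y] by (cases "y = x") auto
    then have "Poly_Mapping.lookup (g x) \<le> (\<lambda>y. a y - 1)" by (rule le_funI)
    then show False using notin g(1) by (auto simp: N_def)
  qed
  let ?L = "range g"
  have "inj g" using off diag by (intro injI) (metis less_irrefl)
  then have "card ?L = CARD('n)" by (rule card_image)
  moreover have "dominant_set ?L"
    unfolding dominant_set_def dominant_in_def
  proof (intro ballI conjI)
    fix m assume "m \<in> ?L"
    then obtain x where m: "m = g x" by blast
    have "\<forall>m'\<in>?L - {m}. Poly_Mapping.lookup m' x < Poly_Mapping.lookup m x"
    proof
      fix m' assume "m' \<in> ?L - {m}"
      then obtain y where "m' = g y" "y \<noteq> x" using m by blast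
      then show "Poly_Mapping.lookup m' x < Poly_Mapping.lookup m x" using off diag m by simp
    qed
    then show "\<exists>x. \<forall>m'\<in>?L - {m}. Poly_Mapping.lookup m' x < Poly_Mapping.lookup m x" by blast
  qed
  moreover have "\<not> strongly_divides h (lcm_expo ?L)" if h: "h \<in> G" for h
  proof
    assume sd: "strongly_divides h (lcm_expo ?L)"
    have "Poly_Mapping.lookup m' x \<le> Poly_Mapping.lookup (g x) x" if m': "m' \<in> ?L" for m' x
    proof -
      obtain y where "m' = g y" using m' by blast
      then show ?thesis using off[of y x] diag[of x] by (cases "y = x") auto
    qed
    then have "Poly_Mapping.lookup (lcm_expo ?L) x = a x" for x
      using lookup_lcm_expo_attained[of "g x" ?L x] diag by auto
    then have "Poly_Mapping.lookup h x < a x" for x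
      using sd pos[of x] by (cases "Poly_Mapping.lookup h x = 0") (auto simp: strongly_divides_def)
    then have "Poly_Mapping.lookup h x \<le> a x - 1" for x
      by (metis Suc_pred' less_Suc_eq_le pos)
    then show False using notin h by (auto simp: N_def le_fun_def)
  qed
  ultimately show ?R using g(1) by (intro exI[of _ ?L]) auto
next
  assume ?R
  then obtain L where L: "L \<subseteq> G" "dominant_set L" "card L = CARD('n)"
    and nsd: "\<And>g. g \<in> G \<Longrightarrow> \<not> strongly_divides g (lcm_expo L)" by blast
  have "finite L" using L(3) by (metis card.infinite finite_UNIV_card_ge_0 finite less_irrefl)
  have "\<forall>m\<in>L. \<exists>x. \<forall>m'\<in>L - {m}. Poly_Mapping.lookup m' x < Poly_Mapping.lookup m x"
    using L(2) by (simp add: dominant_set_def dominant_in_def)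
  then obtain X where X: "\<And>m m'. m \<in> L \<Longrightarrow> m' \<in> L \<Longrightarrow> m' \<noteq> m \<Longrightarrow>
      Poly_Mapping.lookup m' (X m) < Poly_Mapping.lookup m (X m)"
    by (metis DiffI singletonD)
  have "inj_on X L" using X by (intro inj_onI) (metis less_asym)
  then have "card (X ` L) = CARD('n)" using L(3) by (simp add: card_image)
  then have surj: "X ` L = UNIV" by (intro card_subset_eq) auto
  define a where "a = Poly_Mapping.lookup (lcm_expo L)"
  have aX: "a (X m) = Poly_Mapping.lookup m (X m)" if "m \<in> L" for m
    unfolding a_def
  proof (rule lookup_lcm_expo_attained[OF that])
    fix m' assume "m' \<in> L"
    then show "Poly_Mapping.lookup m' (X m) \<le> Poly_Mapping.lookup m (X m)"
      using X[OF that, of m'] by (cases "m' = m") auto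
  qed
  \<comment> \<open>a zero entry is possible only if there is a single variable and \<open>L = {1}\<close>, but \<open>1\<close> strongly divides everything\<close>
  have pos: "0 < a x" for x
  proof (rule ccontr)
    assume "\<not> 0 < a x"
    then have ax: "a x = 0" by simp
    obtain m where m: "m \<in> L" "X m = x" using surj by (metis UNIV_I imageE)
    have "m' = m" if "m' \<in> L" for m' using X[OF m(1) that] aX[OF m(1)] m(2) ax by auto
    then have "y = x" for y using surj m(2) by (metis UNIV_I imageE)
    then have "Poly_Mapping.lookup m y = 0" for y using aX[OF m(1)] m(2) ax by metis
    then have "strongly_divides m (lcm_expo L)" by (simp add: strongly_divides_def)
    then show False using nsd m(1) L(1) by blast
  qed
  have "(\<lambda>x. a x - 1) \<notin> N"
  proof
    assume "(\<lambda>x. a x - 1) \<in> N"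
    then obtain g where g: "g \<in> G" "Poly_Mapping.lookup g \<le> (\<lambda>x. a x - 1)" by (auto simp: N_def)
    have "Poly_Mapping.lookup g x < a x" for x using le_funD[OF g(2), of x] pos[of x] by linarith
    then have "strongly_divides g (lcm_expo L)" by (simp add: strongly_divides_def a_def)
    then show False using nsd g(1) by blast
  qed
  moreover have "(\<lambda>y. a y - 1)(x := a x) \<in> N" for x
  proof -
    obtain m where m: "m \<in> L" "X m = x" using surj by (metis UNIV_I imageE)
    have "Poly_Mapping.lookup m y \<le> ((\<lambda>y. a y - 1)(x := a x)) y" for y
    proof (cases "y = x")
      case True
      then show ?thesis using aX[OF m(1)] m(2) by simp
    next
      case False
      obtain m' where m': "m' \<in> L" "X m' = y" using surj by (metis UNIV_I imageE)
      then have "Poly_Mapping.lookup m y < a y" using X[OF m'(1) m(1)] aX[OF m'(1)] False m(2) by auto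
      then show ?thesis using False by simp
    qed
    then have "Poly_Mapping.lookup m \<le> (\<lambda>y. a y - 1)(x := a x)" by (rule le_funI)
    then show ?thesis using m(1) L(1) unfolding N_def by blast
  qed
  ultimately have "socle_at N UNIV a" using pos by (simp add: socle_at_def shift_def)
  then show ?L by blast
qed

theorem corollary5p3:
  fixes M :: "(('n::finite \<Rightarrow>\<^sub>0 nat) \<Rightarrow>\<^sub>0 'k::field) set"
    and G :: "('n \<Rightarrow>\<^sub>0 nat) set"
  assumes "monomial_ideal M"
    and "minimal_monomial_generators G M"
  shows "pd_quot M = ereal (real CARD('n)) \<longleftrightarrow>
    (\<exists>L\<subseteq>G. dominant_set L \<and> card L = CARD('n) \<and>
       (\<forall>g\<in>G. \<not> strongly_divides g (lcm_expo L)))"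
proof -
  let ?N = "{a. \<exists>g\<in>G. Poly_Mapping.lookup g \<le> a}"
  have "ideal_gen (mono_poly ` G) = M"
    using assms(2) by (simp add: minimal_monomial_generators_def)
  then have "f \<in> M \<longleftrightarrow> (\<forall>m\<in>Poly_Mapping.keys f. Poly_Mapping.lookup m \<in> ?N)" for f
    using ideal_gen_monomials[of f G] by simp
  moreover have "b \<in> ?N" if "a \<in> ?N" "a \<le> b" for a b
    using that by (auto intro: order_trans)
  ultimately have "pd_quot M = ereal (real CARD('n)) \<longleftrightarrow> (\<exists>a. socle_at ?N UNIV a)"
    by (rule pd_quot_eq_nvars_iff)
  then show ?thesis by (simp only: socle_iff_dominant)
qed

end
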